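(* Let $M$ be a von Neumann algebra, let $E$ be a faithful normal conditional expectation defined on $M$, with $N=E(M)$, and let $I_E=\{g\in G_M:L_g(E)=E\}$ and $\mathcal Z_E=G_{M_E}\cdot G_N\subseteq I_E$. Then the group $\mathcal Z_E$ is open, closed and connected in $I_E$. Moreover, the connected component of $I_E$ at any $u\in I_E$ is exactly $u\cdot\mathcal Z_E$.
   Context: $G_A$ denotes the group of invertible elements of a von Neumann algebra $A$; all groups carry the norm topology. For $g\in G_M$, $L_g(E)=gE(g^{-1}\cdot g)g^{-1}$, i.e. $L_g(E)(x)=gE(g^{-1}xg)g^{-1}$. The centralizer of $E$ is the von Neumann algebra $M_E=\{x\in N'\cap M: E(xm)=E(mx)\ \forall m\in M\}$. $G_{M_E}\cdot G_N=\{mn: m\in G_{M_E},\ n\in G_N\}$. *)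

theory Defs
  imports "HOL-Algebra.Group" "HOL-Analysis.Analysis"
begin

text \<open>
  Complex Hilbert spaces. The inner product \<open>cinner\<close> is linear in its first argument. The underlying
  real structure (hence the norm and its topology) is tied to the complex one by \<open>cscale_of_real\<close>
  and \<open>inner_eq_Re_cinner\<close>; the latter gives \<open>cinner x x = (norm x)\<^sup>2\<close>.
\<close>

class chilbert_space = banach + real_inner +
  fixes cscale :: "complex \<Rightarrow> 'a \<Rightarrow> 'a"  (infixr \<open>*\<^sub>C\<close> 75)
    and cinner :: "'a \<Rightarrow> 'a \<Rightarrow> complex"
  assumes cscale_add_right: "c *\<^sub>C (x + y) = c *\<^sub>C x + c *\<^sub>C y"
    and cscale_add_left: "(c + d) *\<^sub>C x = c *\<^sub>C x + d *\<^sub>C x"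
    and cscale_cscale: "c *\<^sub>C d *\<^sub>C x = (c * d) *\<^sub>C x"
    and cscale_of_real: "complex_of_real r *\<^sub>C x = r *\<^sub>R x"
    and cinner_commute: "cinner x y = cnj (cinner y x)"
    and cinner_add_left: "cinner (x + y) z = cinner x z + cinner y z"
    and cinner_cscale_left: "cinner (c *\<^sub>C x) y = c * cinner x y"
    and inner_eq_Re_cinner: "inner x y = Re (cinner x y)"

lemma norm_cscale: "norm (c *\<^sub>C x) = cmod c * norm (x :: 'a :: chilbert_space)"
proof -
  have right: "cinner y (c *\<^sub>C z) = cnj c * cinner y z" for y z :: 'a
    by (metis cinner_commute cinner_cscale_left complex_cnj_mult)
  have "(norm (c *\<^sub>C x))\<^sup>2 = Re ((c * cnj c) * cinner x x)"
    by (simp add: power2_norm_eq_inner inner_eq_Re_cinner cinner_cscale_left right algebra_simps)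
  also have "\<dots> = (cmod c)\<^sup>2 * Re (cinner x x)"
    by (simp add: complex_norm_square[symmetric] flip: of_real_power)
  also have "\<dots> = (cmod c * norm x)\<^sup>2"
    by (simp add: power2_norm_eq_inner inner_eq_Re_cinner power_mult_distrib)
  finally show ?thesis
    by simp
qed

lemma cscale_scaleR: "c *\<^sub>C (r *\<^sub>R x) = r *\<^sub>R (c *\<^sub>C (x :: 'a :: chilbert_space))"
  by (metis cscale_cscale cscale_of_real mult.commute)


section \<open>Bounded operators and von Neumann algebras\<close>

text \<open>
  The type \<open>'h \<Rightarrow>\<^sub>L 'h\<close> consists of the bounded real-linear maps; the algebra of bounded operators on the
  complex Hilbert space is the subset \<open>bounded_ops\<close>. The norm of that type is the operator norm, so
  its topology restricts to the norm topology on sets of operators.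
\<close>

definition bounded_ops :: "('h::chilbert_space \<Rightarrow>\<^sub>L 'h) set" where
  "bounded_ops = {a. \<forall>c x. blinfun_apply a (c *\<^sub>C x) = c *\<^sub>C blinfun_apply a x}"

lift_definition cscale_op :: "complex \<Rightarrow> ('h::chilbert_space \<Rightarrow>\<^sub>L 'h) \<Rightarrow> 'h \<Rightarrow>\<^sub>L 'h"
  is "\<lambda>c f x. c *\<^sub>C f x"
proof -
  fix c :: complex and f :: "'h \<Rightarrow> 'h"
  assume "bounded_linear f"
  moreover have "bounded_linear (\<lambda>x :: 'h. c *\<^sub>C x)"
    by (rule bounded_linear_intro[where K = "cmod c"])
       (simp_all add: cscale_add_right cscale_scaleR norm_cscale mult.commute)
  ultimately show "bounded_linear (\<lambda>x. c *\<^sub>C f x)"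
    using bounded_linear_compose by blast
qed

definition is_adjoint :: "('h::chilbert_space \<Rightarrow>\<^sub>L 'h) \<Rightarrow> ('h \<Rightarrow>\<^sub>L 'h) \<Rightarrow> bool" where
  "is_adjoint a b \<longleftrightarrow>
     (\<forall>x y. cinner (blinfun_apply a x) y = cinner x (blinfun_apply b y))"

definition positive_op :: "('h::chilbert_space \<Rightarrow>\<^sub>L 'h) \<Rightarrow> bool" where
  "positive_op a \<longleftrightarrow> (\<forall>x. cinner (blinfun_apply a x) x \<in> \<real>\<^sub>\<ge>\<^sub>0)"

definition commutant :: "('h::chilbert_space \<Rightarrow>\<^sub>L 'h) set \<Rightarrow> ('h \<Rightarrow>\<^sub>L 'h) set" where
  "commutant S = {a \<in> bounded_ops. \<forall>b\<in>S. a o\<^sub>L b = b o\<^sub>L a}"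

text \<open>
  Being equal to its bicommutant makes \<open>A\<close> a complex subalgebra of the bounded operators that
  contains the identity.
\<close>

definition von_neumann_algebra :: "('h::chilbert_space \<Rightarrow>\<^sub>L 'h) set \<Rightarrow> bool" where
  "von_neumann_algebra A \<longleftrightarrow>
     A \<subseteq> bounded_ops \<and>
     (\<forall>a\<in>A. \<exists>b\<in>A. is_adjoint a b) \<and>
     commutant (commutant A) = A"

definition op_monoid :: "('h::chilbert_space \<Rightarrow>\<^sub>L 'h) set \<Rightarrow> ('h \<Rightarrow>\<^sub>L 'h) monoid" where
  "op_monoid A = \<lparr>carrier = A, monoid.mult = (o\<^sub>L), one = id_blinfun\<rparr>"

text \<open>The group \<open>G\<^sub>A\<close> of invertible elements of \<open>A\<close>.\<close>

abbreviation inv_group :: "('h::chilbert_space \<Rightarrow>\<^sub>L 'h) set \<Rightarrow> ('h \<Rightarrow>\<^sub>L 'h) monoid" where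
  "inv_group A \<equiv> units_of (op_monoid A)"


section \<open>Faithful normal conditional expectations\<close>

definition conditional_expectation ::
    "('h::chilbert_space \<Rightarrow>\<^sub>L 'h) set \<Rightarrow> ('h \<Rightarrow>\<^sub>L 'h) set \<Rightarrow> (('h \<Rightarrow>\<^sub>L 'h) \<Rightarrow> ('h \<Rightarrow>\<^sub>L 'h)) \<Rightarrow> bool" where
  "conditional_expectation M N E \<longleftrightarrow>
     von_neumann_algebra N \<and> N \<subseteq> M \<and> E ` M = N \<and>
     (\<forall>x\<in>M. \<forall>y\<in>M. E (x + y) = E x + E y) \<and>
     (\<forall>c. \<forall>x\<in>M. E (cscale_op c x) = cscale_op c (E x)) \<and>
     (\<forall>x\<in>M. positive_op x \<longrightarrow> positive_op (E x)) \<and>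
     (\<forall>n\<in>N. E n = n) \<and>
     (\<forall>a\<in>N. \<forall>b\<in>N. \<forall>x\<in>M. E (a o\<^sub>L x o\<^sub>L b) = a o\<^sub>L E x o\<^sub>L b)"

definition selfadjoint_part :: "('h::chilbert_space \<Rightarrow>\<^sub>L 'h) set \<Rightarrow> ('h \<Rightarrow>\<^sub>L 'h) set" where
  "selfadjoint_part A = {a \<in> A. is_adjoint a a}"

definition op_le :: "('h::chilbert_space \<Rightarrow>\<^sub>L 'h) \<Rightarrow> ('h \<Rightarrow>\<^sub>L 'h) \<Rightarrow> bool" where
  "op_le a b \<longleftrightarrow> positive_op (b - a)"

definition is_op_sup ::
    "('h::chilbert_space \<Rightarrow>\<^sub>L 'h) set \<Rightarrow> ('h \<Rightarrow>\<^sub>L 'h) set \<Rightarrow> ('h \<Rightarrow>\<^sub>L 'h) \<Rightarrow> bool" where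
  "is_op_sup A D s \<longleftrightarrow>
     s \<in> selfadjoint_part A \<and> (\<forall>d\<in>D. op_le d s) \<and>
     (\<forall>t \<in> selfadjoint_part A. (\<forall>d\<in>D. op_le d t) \<longrightarrow> op_le s t)"

text \<open>
  Normality: suprema of bounded increasing nets of self-adjoint elements are preserved. The nets are
  given by their ranges, the nonempty upward directed sets.
\<close>

definition normal_map ::
    "('h::chilbert_space \<Rightarrow>\<^sub>L 'h) set \<Rightarrow> ('h \<Rightarrow>\<^sub>L 'h) set \<Rightarrow> (('h \<Rightarrow>\<^sub>L 'h) \<Rightarrow> ('h \<Rightarrow>\<^sub>L 'h)) \<Rightarrow> bool" where
  "normal_map M N E \<longleftrightarrow>
     (\<forall>D s. D \<noteq> {} \<longrightarrow> D \<subseteq> selfadjoint_part M \<longrightarrow>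
        (\<forall>a\<in>D. \<forall>b\<in>D. \<exists>c\<in>D. op_le a c \<and> op_le b c) \<longrightarrow>
        is_op_sup M D s \<longrightarrow> is_op_sup N (E ` D) (E s))"

definition faithful_map ::
    "('h::chilbert_space \<Rightarrow>\<^sub>L 'h) set \<Rightarrow> (('h \<Rightarrow>\<^sub>L 'h) \<Rightarrow> ('h \<Rightarrow>\<^sub>L 'h)) \<Rightarrow> bool" where
  "faithful_map M E \<longleftrightarrow> (\<forall>x\<in>M. positive_op x \<longrightarrow> E x = 0 \<longrightarrow> x = 0)"


section \<open>The isotropy group and the centralizer\<close>

definition conj_exp ::
    "('h::chilbert_space \<Rightarrow>\<^sub>L 'h) set \<Rightarrow> ('h \<Rightarrow>\<^sub>L 'h) \<Rightarrow> (('h \<Rightarrow>\<^sub>L 'h) \<Rightarrow> ('h \<Rightarrow>\<^sub>L 'h)) \<Rightarrow>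
     ('h \<Rightarrow>\<^sub>L 'h) \<Rightarrow> ('h \<Rightarrow>\<^sub>L 'h)" where
  "conj_exp M g E x =
     (let h = inv\<^bsub>inv_group M\<^esub> g in g o\<^sub>L E (h o\<^sub>L x o\<^sub>L g) o\<^sub>L h)"

text \<open>Maps on \<open>M\<close> are total functions here, so equality of maps means agreement on \<open>M\<close>.\<close>

definition isotropy_group ::
    "('h::chilbert_space \<Rightarrow>\<^sub>L 'h) set \<Rightarrow> (('h \<Rightarrow>\<^sub>L 'h) \<Rightarrow> ('h \<Rightarrow>\<^sub>L 'h)) \<Rightarrow> ('h \<Rightarrow>\<^sub>L 'h) set" where
  "isotropy_group M E = {g \<in> carrier (inv_group M). \<forall>x\<in>M. conj_exp M g E x = E x}"

definition centralizer ::
    "('h::chilbert_space \<Rightarrow>\<^sub>L 'h) set \<Rightarrow> ('h \<Rightarrow>\<^sub>L 'h) set \<Rightarrow> (('h \<Rightarrow>\<^sub>L 'h) \<Rightarrow> ('h \<Rightarrow>\<^sub>L 'h)) \<Rightarrow>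
     ('h \<Rightarrow>\<^sub>L 'h) set" where
  "centralizer M N E = {x \<in> commutant N \<inter> M. \<forall>m\<in>M. E (x o\<^sub>L m) = E (m o\<^sub>L x)}"

definition Z_group ::
    "('h::chilbert_space \<Rightarrow>\<^sub>L 'h) set \<Rightarrow> ('h \<Rightarrow>\<^sub>L 'h) set \<Rightarrow> (('h \<Rightarrow>\<^sub>L 'h) \<Rightarrow> ('h \<Rightarrow>\<^sub>L 'h)) \<Rightarrow>
     ('h \<Rightarrow>\<^sub>L 'h) set" where
  "Z_group M N E =
     {m o\<^sub>L n | m n. m \<in> carrier (inv_group (centralizer M N E)) \<and> n \<in> carrier (inv_group N)}"

end

theory Submission
  imports Defs
begin

text \<open>
  If \<open>g\<close> lies in the isotropy group, then \<open>g n g\<^sup>-\<^sup>1 \<in> N\<close> for \<open>n \<in> N\<close>, and applying \<open>E\<close> to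
  \<open>g n = (g n g\<^sup>-\<^sup>1) g\<close> shows that \<open>E g\<close> intertwines \<open>N\<close> in the same way as \<open>g\<close>. Near the identity
  \<open>E g\<close> is invertible, so \<open>(E g)\<^sup>-\<^sup>1 g\<close> commutes with \<open>N\<close> and hence lies in the centralizer. Thus the
  product group contains a neighbourhood of the identity in the isotropy group and is clopen there.

  For connectedness it is enough that the invertible groups of \<open>N\<close> and of the centralizer are
  connected. An invertible \<open>g\<close> is joined to its unitary part \<open>u\<close> by a segment (polar decomposition),
  \<open>u\<close> is joined by a segment to the symmetry \<open>s = sgn (Re u)\<close>, because \<open>Re (s u) \<ge> 0\<close>, and \<open>s\<close> is
  joined to the identity by rotating its negative spectral subspace. The sign is obtained as a
  monotone limit, under which the centralizer is closed since \<open>E\<close> is normal.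
\<close>

section \<open>Positive operators on real Hilbert spaces\<close>

text \<open>The sign function is discontinuous, so limits in norm cannot produce the symmetry in
  general; indeed norm closure would not be enough, as the invertible group of the C*-algebra of
  continuous functions on the circle is disconnected. Strong limits are therefore essential, and the
  crux is that the centralizer, defined through \<open>E\<close>, admits those that are needed.
  Inverses and square roots are obtained by contraction or as limits in norm; a strong limit is used
  in one construction, the projection onto a kernel. Operators are mostly handled as real-linear
  maps of the underlying real Hilbert space, where quadratic forms are real numbers; complex scalars
  return in the positivity of \<open>E\<close>, in Cartesian decompositions and in the rotation
  through \<open>\<i>\<close>.\<close>

definition sym_op :: "('h::real_inner \<Rightarrow>\<^sub>L 'h) \<Rightarrow> bool" where
  "sym_op a \<longleftrightarrow> (\<forall>x y. inner (blinfun_apply a x) y = inner x (blinfun_apply a y))"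

text \<open>Symmetry is demanded separately because over the reals a quadratic form does not see the
  skew part of an operator. For complex-linear operators \<open>positive_op_iff_psd\<close>
  identifies this notion with \<open>positive_op\<close>.\<close>

definition psd :: "('h::real_inner \<Rightarrow>\<^sub>L 'h) \<Rightarrow> bool" where
  "psd a \<longleftrightarrow> sym_op a \<and> (\<forall>x. 0 \<le> inner (blinfun_apply a x) x)"

lemmas op_simps = blinfun.add_left blinfun.add_right blinfun.diff_left blinfun.diff_right
  blinfun.minus_left blinfun.minus_right blinfun.scaleR_left blinfun.scaleR_right
  inner_add_left inner_add_right inner_diff_left inner_diff_right

lemma compose_assoc: "(a o\<^sub>L b) o\<^sub>L c = a o\<^sub>L (b o\<^sub>L c)"
  by (rule blinfun_eqI) simp

lemma compose_id [simp]: "a o\<^sub>L id_blinfun = a" "id_blinfun o\<^sub>L a = a"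
  by (auto intro: blinfun_eqI)

lemmas compose_bilinear =
  bounded_bilinear.add_left[OF bounded_bilinear_blinfun_compose]
  bounded_bilinear.add_right[OF bounded_bilinear_blinfun_compose]
  bounded_bilinear.diff_left[OF bounded_bilinear_blinfun_compose]
  bounded_bilinear.diff_right[OF bounded_bilinear_blinfun_compose]
  bounded_bilinear.scaleR_left[OF bounded_bilinear_blinfun_compose]
  bounded_bilinear.scaleR_right[OF bounded_bilinear_blinfun_compose]

lemma cancel_inverse:
  assumes "g o\<^sub>L h = id_blinfun"
  shows "g o\<^sub>L (h o\<^sub>L x) = x" "(x o\<^sub>L g) o\<^sub>L h = x"
  using assms by (metis compose_assoc compose_id)+

lemma sym_opD: "sym_op a \<Longrightarrow> inner (blinfun_apply a x) y = inner x (blinfun_apply a y)"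
  by (simp add: sym_op_def)

lemma psdD:
  assumes "psd a" shows "sym_op a" "0 \<le> inner (blinfun_apply a x) x"
  using assms by (auto simp: psd_def)

lemma sym_op_id: "sym_op id_blinfun"
  by (simp add: sym_op_def)

lemma sym_op_add: "sym_op a \<Longrightarrow> sym_op b \<Longrightarrow> sym_op (a + b)"
  by (simp add: sym_op_def op_simps)

lemma sym_op_diff: "sym_op a \<Longrightarrow> sym_op b \<Longrightarrow> sym_op (a - b)"
  by (simp add: sym_op_def op_simps)

lemma sym_op_scaleR: "sym_op a \<Longrightarrow> sym_op (r *\<^sub>R a)"
  by (simp add: sym_op_def op_simps)

lemma sym_op_square: "sym_op a \<Longrightarrow> sym_op (a o\<^sub>L a)"
  by (simp add: sym_op_def)

lemma psd_square: "sym_op a \<Longrightarrow> psd (a o\<^sub>L a)"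
  unfolding psd_def by (metis blinfun_apply_blinfun_compose inner_ge_zero sym_opD sym_op_square)

lemma psd_add: "psd a \<Longrightarrow> psd b \<Longrightarrow> psd (a + b)"
  by (simp add: psd_def sym_op_add op_simps)

lemma psd_scaleR: "psd a \<Longrightarrow> 0 \<le> r \<Longrightarrow> psd (r *\<^sub>R a)"
  by (simp add: psd_def sym_op_scaleR op_simps)

lemma psd_id: "psd id_blinfun"
  by (simp add: psd_def sym_op_id)

lemma psd_tendsto:
  assumes "\<And>n. psd (b n)" and lim: "\<And>x. (\<lambda>n. blinfun_apply (b n) x) \<longlonglongrightarrow> blinfun_apply a x"
  shows "psd a"
proof -
  have sym: "inner (blinfun_apply a x) y = inner x (blinfun_apply a y)" for x y
  proof (rule LIMSEQ_unique)
    show "(\<lambda>n. inner (blinfun_apply (b n) x) y) \<longlonglongrightarrow> inner (blinfun_apply a x) y"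
      by (intro tendsto_intros lim)
    have "(\<lambda>n. inner x (blinfun_apply (b n) y)) \<longlonglongrightarrow> inner x (blinfun_apply a y)"
      by (intro tendsto_intros lim)
    then show "(\<lambda>n. inner (blinfun_apply (b n) x) y) \<longlonglongrightarrow> inner x (blinfun_apply a y)"
      using assms(1) by (simp add: psd_def sym_op_def)
  qed
  have "0 \<le> inner (blinfun_apply a x) x" for x
  proof (rule LIMSEQ_le_const)
    show "(\<lambda>n. inner (blinfun_apply (b n) x) x) \<longlonglongrightarrow> inner (blinfun_apply a x) x"
      by (intro tendsto_intros lim)
    show "\<exists>N. \<forall>n\<ge>N. 0 \<le> inner (blinfun_apply (b n) x) x"
      using assms(1) by (simp add: psd_def)
  qed
  then show ?thesis using sym by (simp add: psd_def sym_op_def)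
qed

lemma psd_increasing:
  assumes mono: "\<And>n. psd (b (Suc n) - b n)" and "n \<le> m"
  shows "psd (b m - b n)"
  using assms(2)
proof (induction m rule: dec_induct)
  case base then show ?case by (simp add: psd_def sym_op_def)
next
  case (step m)
  then show ?case using psd_add[OF mono[of m] step.IH] by simp
qed

lemma psd_limit_diff:
  assumes mono: "\<And>n. psd (b (Suc n) - b n)"
    and lim: "\<And>x. (\<lambda>n. blinfun_apply (b n) x) \<longlonglongrightarrow> blinfun_apply p x"
  shows "psd (p - b n)"
proof (rule psd_tendsto[where b = "\<lambda>k. b (k + n) - b n"])
  show "psd (b (k + n) - b n)" for k by (rule psd_increasing[where b = b, OF mono]) simp
  show "(\<lambda>k. blinfun_apply (b (k + n) - b n) x) \<longlonglongrightarrow> blinfun_apply (p - b n) x" for x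
    unfolding blinfun.diff_left
    by (intro tendsto_diff tendsto_const) (rule LIMSEQ_ignore_initial_segment[OF lim])
qed

section \<open>Norm estimates from quadratic forms\<close>

lemma quadratic_nonneg_discriminant:
  fixes A B C :: real
  assumes "\<And>t. 0 \<le> A + 2 * t * B + t\<^sup>2 * C"
  shows "B\<^sup>2 \<le> A * C"
proof (cases "C = 0")
  case True
  have "B = 0"
  proof (rule ccontr)
    assume "B \<noteq> 0"
    then show False using assms[of "- (A + 1) / (2 * B)"] True by (simp add: field_simps)
  qed
  then show ?thesis using True by simp
next
  case False
  have "0 \<le> C"
  proof (rule ccontr)
    assume "\<not> 0 \<le> C"
    \<comment> \<open>A negative \<open>C\<close> must lose for large \<open>t\<close>: this choice
      gives \<open>t * C = C - \<bar>A\<bar> - 1 - 2 * \<bar>B\<bar>\<close>, which absorbs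
      \<open>A\<close> and \<open>2 * B\<close>; the added 1 ensures
      \<open>t \<ge> 1\<close>.\<close>
    define t where "t = (\<bar>A\<bar> + 1 + 2 * \<bar>B\<bar>) / (- C) + 1"
    have "t \<ge> 1" using \<open>\<not> 0 \<le> C\<close> by (simp add: t_def divide_nonneg_neg divide_nonpos_pos divide_le_0_iff)
    have "t * (- C) = \<bar>A\<bar> + 1 + 2 * \<bar>B\<bar> - C" using \<open>\<not> 0 \<le> C\<close> by (simp add: t_def field_simps)
    then have tC: "t * C = C - \<bar>A\<bar> - 1 - 2 * \<bar>B\<bar>" by simp
    have "t * (2 * B + t * C) = t * (2 * B - \<bar>A\<bar> - 1 - 2 * \<bar>B\<bar> + C)"
      unfolding tC by (simp add: algebra_simps)
    also have "\<dots> \<le> t * (- \<bar>A\<bar> - 1)"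
      using \<open>t \<ge> 1\<close> \<open>\<not> 0 \<le> C\<close> by (intro mult_left_mono) auto
    also have "\<dots> \<le> - \<bar>A\<bar> - 1"
      using \<open>t \<ge> 1\<close> mult_right_mono[of 1 t "\<bar>A\<bar> + 1"] by (simp add: algebra_simps)
    finally show False using assms[of t] by (simp add: algebra_simps power2_eq_square)
  qed
  with False have "0 < C" by simp
  have "A + 2 * (- B / C) * B + (- B / C)\<^sup>2 * C = A - B\<^sup>2 / C"
    using \<open>0 < C\<close> by (simp add: field_simps power2_eq_square)
  then have "B\<^sup>2 / C \<le> A" using assms[of "- B / C"] by simp
  then show ?thesis using \<open>0 < C\<close> by (simp add: pos_divide_le_eq)
qed

lemma psd_Cauchy_Schwarz:
  assumes "psd a"
  shows "(inner (blinfun_apply a x) y)\<^sup>2 \<le> inner (blinfun_apply a x) x * inner (blinfun_apply a y) y"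
proof (rule quadratic_nonneg_discriminant)
  fix t
  have "inner (blinfun_apply a y) x = inner (blinfun_apply a x) y"
    using sym_opD[OF psdD(1)[OF assms], of y x] by (simp add: inner_commute)
  then have "inner (blinfun_apply a (x + t *\<^sub>R y)) (x + t *\<^sub>R y)
    = inner (blinfun_apply a x) x + 2 * t * inner (blinfun_apply a x) y
      + t\<^sup>2 * inner (blinfun_apply a y) y"
    by (simp add: op_simps power2_eq_square algebra_simps)
  then show "0 \<le> inner (blinfun_apply a x) x + 2 * t * inner (blinfun_apply a x) y
      + t\<^sup>2 * inner (blinfun_apply a y) y"
    using psdD(2)[OF assms, of "x + t *\<^sub>R y"] by simp
qed

text \<open>The operator inequality behind this is that the square of \<open>a\<close> is at most
  \<open>a\<close> whenever 0 <= a <= 1. Cauchy-Schwarz is taken at \<open>y = a x\<close>, and one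
  factor of the squared norm of \<open>y\<close> cancels.\<close>

lemma psd_le_id_norm:
  assumes "psd a" and "\<And>x. inner (blinfun_apply a x) x \<le> (norm x)\<^sup>2"
  shows "(norm (blinfun_apply a x))\<^sup>2 \<le> inner (blinfun_apply a x) x"
proof -
  let ?y = "blinfun_apply a x"
  have "((norm ?y)\<^sup>2)\<^sup>2 \<le> inner ?y x * inner (blinfun_apply a ?y) ?y"
    using psd_Cauchy_Schwarz[OF assms(1), of x ?y] by (simp add: power2_norm_eq_inner)
  also have "\<dots> \<le> inner ?y x * (norm ?y)\<^sup>2"
    using assms psdD(2) by (intro mult_left_mono) auto
  finally have "(norm ?y)\<^sup>2 * (norm ?y)\<^sup>2 \<le> inner ?y x * (norm ?y)\<^sup>2"
    by (simp only: power2_eq_square)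
  then show ?thesis
    using psdD(2)[OF assms(1), of x]
      mult_right_le_imp_le[of "(norm ?y)\<^sup>2" "(norm ?y)\<^sup>2" "inner ?y x"]
    by (cases "?y = 0") auto
qed

text \<open>Polarisation expresses \<open>inner (a x) y\<close> by the form at \<open>x + y\<close>
  and \<open>x - y\<close>, and the parallelogram law bounds the two values together.\<close>

lemma sym_op_norm_le:
  assumes "sym_op a" "0 \<le> c" and le: "\<And>x. \<bar>inner (blinfun_apply a x) x\<bar> \<le> c * (norm x)\<^sup>2"
  shows "norm a \<le> c"
proof (rule norm_blinfun_bound)
  fix x
  have pol: "2 * inner (blinfun_apply a x) y \<le> c * ((norm x)\<^sup>2 + (norm y)\<^sup>2)" for y
  proof -
    have "inner (blinfun_apply a y) x = inner (blinfun_apply a x) y"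
      using sym_opD[OF assms(1), of y x] by (simp add: inner_commute)
    then have "4 * inner (blinfun_apply a x) y
      = inner (blinfun_apply a (x + y)) (x + y) - inner (blinfun_apply a (x - y)) (x - y)"
      by (simp add: op_simps)
    also have "\<dots> \<le> c * (norm (x + y))\<^sup>2 + c * (norm (x - y))\<^sup>2"
      using le[of "x + y"] le[of "x - y"] by linarith
    also have "\<dots> = 2 * (c * ((norm x)\<^sup>2 + (norm y)\<^sup>2))"
      by (simp add: power2_norm_eq_inner op_simps inner_commute algebra_simps)
    finally show ?thesis by simp
  qed
  show "norm (blinfun_apply a x) \<le> c * norm x"
  proof (cases "norm (blinfun_apply a x) = 0 \<or> norm x = 0")
    case True then show ?thesis using assms(2) by auto
  next
    case False
    define z where "z = blinfun_apply a x"
    have z: "norm z > 0" "norm x > 0" using False by (auto simp: z_def)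
    \<comment> \<open>The test vector points along \<open>a x\<close> and has the length of
      \<open>x\<close>, so that the two squared norms in \<open>pol\<close> agree.\<close>
    have "2 * inner z ((norm x / norm z) *\<^sub>R z) = 2 * (norm x * norm z)"
      using z by (simp add: power2_norm_eq_inner[symmetric] power2_eq_square)
    moreover have "(norm ((norm x / norm z) *\<^sub>R z))\<^sup>2 = (norm x)\<^sup>2"
      using z by simp
    ultimately have "norm x * norm z \<le> norm x * (c * norm x)"
      using pol[of "(norm x / norm z) *\<^sub>R z"] by (simp add: z_def power2_eq_square algebra_simps)
    then show ?thesis using z by (simp add: z_def)
  qed
qed (fact assms(2))

section \<open>Invertibility by contraction\<close>

text \<open>A right inverse is a fixed point of the contraction sending \<open>b\<close> to
  \<open>1 + (1 - a) b\<close>; the mirrored map yields a left inverse, and associativity identifies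
  the two.\<close>

lemma Neumann_invertible:
  fixes a :: "'h::banach \<Rightarrow>\<^sub>L 'h"
  assumes "norm (id_blinfun - a) < 1"
  shows "\<exists>b. a o\<^sub>L b = id_blinfun \<and> b o\<^sub>L a = id_blinfun"
proof -
  let ?r = "norm (id_blinfun - a)"
  have "\<exists>!b\<in>UNIV. id_blinfun + ((id_blinfun - a) o\<^sub>L b) = b"
  proof (rule Banach_fix[where c = ?r])
    fix b c :: "'h \<Rightarrow>\<^sub>L 'h"
    have "(id_blinfun + ((id_blinfun - a) o\<^sub>L b)) - (id_blinfun + ((id_blinfun - a) o\<^sub>L c))
      = (id_blinfun - a) o\<^sub>L (b - c)"
      by (rule blinfun_eqI) (simp add: op_simps)
    then show "dist (id_blinfun + ((id_blinfun - a) o\<^sub>L b)) (id_blinfun + ((id_blinfun - a) o\<^sub>L c))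
      \<le> ?r * dist b c"
      by (metis dist_norm norm_blinfun_compose)
  qed (use assms in \<open>auto simp: complete_UNIV\<close>)
  then obtain b where b: "id_blinfun + ((id_blinfun - a) o\<^sub>L b) = b" by blast
  have "\<exists>!b\<in>UNIV. id_blinfun + (b o\<^sub>L (id_blinfun - a)) = b"
  proof (rule Banach_fix[where c = ?r])
    fix b c :: "'h \<Rightarrow>\<^sub>L 'h"
    have "(id_blinfun + (b o\<^sub>L (id_blinfun - a))) - (id_blinfun + (c o\<^sub>L (id_blinfun - a)))
      = (b - c) o\<^sub>L (id_blinfun - a)"
      by (rule blinfun_eqI) (simp add: op_simps)
    then show "dist (id_blinfun + (b o\<^sub>L (id_blinfun - a))) (id_blinfun + (c o\<^sub>L (id_blinfun - a)))
      \<le> ?r * dist b c"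
      by (metis dist_norm norm_blinfun_compose mult.commute)
  qed (use assms in \<open>auto simp: complete_UNIV\<close>)
  then obtain c where c: "id_blinfun + (c o\<^sub>L (id_blinfun - a)) = c" by blast
  have ab: "a o\<^sub>L b = id_blinfun"
  proof (rule blinfun_eqI)
    fix x
    have "blinfun_apply (id_blinfun + ((id_blinfun - a) o\<^sub>L b)) x = blinfun_apply b x"
      by (simp only: b)
    then show "blinfun_apply (a o\<^sub>L b) x = blinfun_apply id_blinfun x"
      by (simp add: op_simps)
  qed
  have ca: "c o\<^sub>L a = id_blinfun"
  proof (rule blinfun_eqI)
    fix x
    have "blinfun_apply (id_blinfun + (c o\<^sub>L (id_blinfun - a))) x = blinfun_apply c x"
      by (simp only: c)
    then show "blinfun_apply (c o\<^sub>L a) x = blinfun_apply id_blinfun x"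
      by (simp add: op_simps)
  qed
  have "c = b"
    by (metis ab ca compose_assoc compose_id)
  then show ?thesis using ab ca by blast
qed

text \<open>As in the Lax-Milgram theorem, a small multiple of \<open>a\<close> is closer than 1 to
  the identity. Symmetry of \<open>a\<close> is not asked for, so that the lemma applies to
  \<open>(1 - t) + t s u\<close> with \<open>u\<close> unitary.\<close>

lemma coercive_invertible:
  fixes a :: "'h::{banach,real_inner} \<Rightarrow>\<^sub>L 'h"
  assumes c: "0 < c" and coercive: "\<And>x. c * (norm x)\<^sup>2 \<le> inner (blinfun_apply a x) x"
  shows "\<exists>b. a o\<^sub>L b = id_blinfun \<and> b o\<^sub>L a = id_blinfun"
proof -
  \<comment> \<open>The squared norm of \<open>1 - l a\<close> is at most
    \<open>1 - 2 l c + l\<^sup>2 K\<^sup>2\<close>, and \<open>l = c / K\<^sup>2\<close> minimises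
    this to \<open>1 - c\<^sup>2 / K\<^sup>2\<close>. Adding \<open>c\<close> to
    \<open>norm a\<close> keeps the minimum nonnegative, so \<open>r\<close> is its square
    root.\<close>
  define K where "K = norm a + c"
  define l where "l = c / K\<^sup>2"
  have K: "K > 0" "c \<le> K" "norm a \<le> K" using c by (auto simp: K_def add_nonneg_pos)
  have l: "l > 0" using c K by (simp add: l_def)
  define r where "r = sqrt (1 - c\<^sup>2 / K\<^sup>2)"
  have cK: "0 \<le> 1 - c\<^sup>2 / K\<^sup>2" "1 - c\<^sup>2 / K\<^sup>2 < 1"
    using c K by (auto simp: field_simps power_mono)
  have r: "0 \<le> r" "r < 1" "r\<^sup>2 = 1 - c\<^sup>2 / K\<^sup>2"
    using cK by (auto simp: r_def)
  have "norm (id_blinfun - l *\<^sub>R a) \<le> r"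
  proof (rule norm_blinfun_bound)
    fix x
    have "norm (blinfun_apply a x) \<le> K * norm x"
      using norm_blinfun[of a x] K mult_right_mono[of "norm a" K "norm x"] by auto
    then have ax: "(norm (blinfun_apply a x))\<^sup>2 \<le> K\<^sup>2 * (norm x)\<^sup>2"
      by (metis norm_ge_zero power_mono power_mult_distrib)
    have "(norm (x - l *\<^sub>R blinfun_apply a x))\<^sup>2
      = (norm x)\<^sup>2 - 2 * l * inner (blinfun_apply a x) x + l\<^sup>2 * (norm (blinfun_apply a x))\<^sup>2"
      by (simp only: power2_norm_eq_inner)
        (simp add: op_simps inner_commute power2_eq_square algebra_simps)
    also have "\<dots> \<le> (norm x)\<^sup>2 - 2 * l * (c * (norm x)\<^sup>2) + l\<^sup>2 * (K\<^sup>2 * (norm x)\<^sup>2)"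
      using coercive[of x] ax l by (intro add_mono diff_mono mult_left_mono) auto
    also have "\<dots> = r\<^sup>2 * (norm x)\<^sup>2"
    proof -
      have "l * c = c\<^sup>2 / K\<^sup>2" "l\<^sup>2 * K\<^sup>2 = c\<^sup>2 / K\<^sup>2"
        using K by (simp_all add: l_def power2_eq_square)
      then have *: "r\<^sup>2 = 1 - 2 * (l * c) + l\<^sup>2 * K\<^sup>2" by (simp add: r)
      show ?thesis unfolding * by (simp add: algebra_simps)
    qed
    finally have "norm (x - l *\<^sub>R blinfun_apply a x) \<le> r * norm x"
      by (metis norm_ge_zero power2_le_imp_le power_mult_distrib r(1) mult_nonneg_nonneg)
    then show "norm (blinfun_apply (id_blinfun - l *\<^sub>R a) x) \<le> r * norm x"
      by (simp add: op_simps)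
  qed (fact r(1))
  with r(2) have "norm (id_blinfun - l *\<^sub>R a) < 1" by simp
  then obtain b where b: "(l *\<^sub>R a) o\<^sub>L b = id_blinfun" "b o\<^sub>L (l *\<^sub>R a) = id_blinfun"
    using Neumann_invertible by blast
  have "a o\<^sub>L (l *\<^sub>R b) = id_blinfun" "(l *\<^sub>R b) o\<^sub>L a = id_blinfun"
    using b by (auto simp: compose_bilinear)
  then show ?thesis by blast
qed

section \<open>Strong limits of bounded monotone sequences\<close>

lemma bounded_limit_blinfun:
  fixes b :: "nat \<Rightarrow> 'h::real_normed_vector \<Rightarrow>\<^sub>L 'k::real_normed_vector"
  assumes "\<And>x. convergent (\<lambda>n. blinfun_apply (b n) x)" "\<And>n. norm (b n) \<le> K"
  obtains a where "\<And>x. (\<lambda>n. blinfun_apply (b n) x) \<longlonglongrightarrow> blinfun_apply a x"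
proof -
  define f where "f x = lim (\<lambda>n. blinfun_apply (b n) x)" for x
  have lim: "(\<lambda>n. blinfun_apply (b n) x) \<longlonglongrightarrow> f x" for x
    using assms(1) by (simp add: f_def convergent_LIMSEQ_iff)
  have "bounded_linear f"
  proof (rule bounded_linear_intro)
    show "f (x + y) = f x + f y" for x y
    proof (rule LIMSEQ_unique[OF lim])
      show "(\<lambda>n. blinfun_apply (b n) (x + y)) \<longlonglongrightarrow> f x + f y"
        unfolding blinfun.add_right by (intro tendsto_intros lim)
    qed
    show "f (r *\<^sub>R x) = r *\<^sub>R f x" for r x
    proof (rule LIMSEQ_unique[OF lim])
      show "(\<lambda>n. blinfun_apply (b n) (r *\<^sub>R x)) \<longlonglongrightarrow> r *\<^sub>R f x"
        unfolding blinfun.scaleR_right by (intro tendsto_intros lim)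
    qed
    show "norm (f x) \<le> norm x * K" for x
    proof (rule LIMSEQ_le_const2)
      show "(\<lambda>n. norm (blinfun_apply (b n) x)) \<longlonglongrightarrow> norm (f x)"
        by (intro tendsto_intros lim)
      show "\<exists>N. \<forall>n\<ge>N. norm (blinfun_apply (b n) x) \<le> norm x * K"
        using assms(2) norm_blinfun
        by (metis mult.commute mult_left_mono norm_ge_zero order_trans)
    qed
  qed
  then show thesis using lim that[of "Blinfun f"] by (simp add: bounded_linear_Blinfun_apply)
qed

text \<open>Vigier's theorem for sequences. For fixed \<open>x\<close> the numbers
  \<open>q n\<close> increase and are bounded; differences of the \<open>b n\<close> lie between 0
  and 1, so \<open>psd_le_id_norm\<close> bounds the squared distance of \<open>b m x\<close> and
  \<open>b n x\<close> by the difference of \<open>q\<close>. Cauchyness thus passes from scalars to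
  vectors.\<close>

lemma monotone_psd_limit:
  fixes b :: "nat \<Rightarrow> 'h::{banach,real_inner} \<Rightarrow>\<^sub>L 'h"
  assumes pos: "\<And>n. psd (b n)" and le: "\<And>n. psd (id_blinfun - b n)"
    and mono: "\<And>n. psd (b (Suc n) - b n)"
  obtains p where "\<And>x. (\<lambda>n. blinfun_apply (b n) x) \<longlonglongrightarrow> blinfun_apply p x"
proof (rule bounded_limit_blinfun[where b = b and K = 1])
  have le': "inner (blinfun_apply (b n) x) x \<le> (norm x)\<^sup>2" for n x
    using psdD(2)[OF le[of n], of x] by (simp add: op_simps power2_norm_eq_inner)
  have diff: "psd (b m - b n)" if "n \<le> m" for n m
    by (rule psd_increasing[where b = b, OF mono that])
  show "norm (b n) \<le> 1" for n
    using pos[of n] le'[of n] by (intro sym_op_norm_le) (auto simp: psd_def)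
  fix x
  define q where "q n = inner (blinfun_apply (b n) x) x" for n
  have "incseq q"
    using psdD(2)[OF mono, of _ x] by (intro incseq_SucI) (simp add: q_def op_simps)
  moreover have "\<bar>q n\<bar> \<le> (norm x)\<^sup>2" for n
    using psdD(2)[OF pos, of n x] le'[of n x] by (simp add: q_def)
  then have "Bseq q" by (intro BseqI') auto
  ultimately have "Cauchy q"
    using Bseq_monoseq_convergent[of q] convergent_Cauchy by (auto simp: incseq_imp_monoseq)
  have key: "(norm (blinfun_apply (b m) x - blinfun_apply (b n) x))\<^sup>2 \<le> \<bar>q m - q n\<bar>" for m n
  proof (induction m n rule: linorder_wlog)
    case (sym m n) then show ?case by (simp add: norm_minus_commute abs_minus_commute)
  next
    case (le m n)
    have "inner (blinfun_apply (b n - b m) y) y \<le> (norm y)\<^sup>2" for y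
      using le'[of n y] psdD(2)[OF pos[of m], of y] by (simp add: op_simps)
    then have "(norm (blinfun_apply (b n - b m) x))\<^sup>2 \<le> q n - q m"
      using psd_le_id_norm[OF diff[OF le], of x] by (simp add: q_def op_simps)
    then show ?case by (simp add: op_simps norm_minus_commute)
  qed
  have "Cauchy (\<lambda>n. blinfun_apply (b n) x)"
  proof (rule metric_CauchyI)
    fix e :: real assume "e > 0"
    then obtain N where "\<forall>m\<ge>N. \<forall>n\<ge>N. dist (q m) (q n) < e\<^sup>2"
      using \<open>Cauchy q\<close> metric_CauchyD[of q "e\<^sup>2"] by auto
    then have "dist (blinfun_apply (b m) x) (blinfun_apply (b n) x) < e" if "m \<ge> N" "n \<ge> N" for m n
      using key[of m n] that \<open>e > 0\<close>
      by (intro power2_less_imp_less[of _ e]) (auto simp: dist_norm intro: order.strict_trans1)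
    then show "\<exists>N. \<forall>m\<ge>N. \<forall>n\<ge>N. dist (blinfun_apply (b m) x) (blinfun_apply (b n) x) < e"
      by blast
  qed
  then show "convergent (\<lambda>n. blinfun_apply (b n) x)"
    by (simp add: Cauchy_convergent)
qed (use that in blast)

section \<open>Square roots and signs in operator algebras\<close>

text \<open>The bicommutant of the single operator \<open>a\<close> among all real-linear bounded
  operators. It plays the role of the algebra of functions of \<open>a\<close>.\<close>

definition bicommuting :: "('h::real_normed_vector \<Rightarrow>\<^sub>L 'h) \<Rightarrow> ('h \<Rightarrow>\<^sub>L 'h) set" where
  "bicommuting a = {b. \<forall>c. a o\<^sub>L c = c o\<^sub>L a \<longrightarrow> b o\<^sub>L c = c o\<^sub>L b}"

text \<open>Closure under monotone sequential limits stands in for weak closedness: for the centralizer it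
  follows directly from the normality of \<open>E\<close>, with no appeal to the bicommutant theorem.\<close>

locale op_algebra =
  fixes A :: "('h::{banach,real_inner} \<Rightarrow>\<^sub>L 'h) set"
  assumes id_in: "id_blinfun \<in> A"
    and add_in: "a \<in> A \<Longrightarrow> b \<in> A \<Longrightarrow> a + b \<in> A"
    and scaleR_in: "a \<in> A \<Longrightarrow> r *\<^sub>R a \<in> A"
    and compose_in: "a \<in> A \<Longrightarrow> b \<in> A \<Longrightarrow> a o\<^sub>L b \<in> A"
    and inverse_in: "a \<in> A \<Longrightarrow> a o\<^sub>L b = id_blinfun \<Longrightarrow> b o\<^sub>L a = id_blinfun \<Longrightarrow> b \<in> A"
    and closed: "closed A"
    and monotone_limit_in: "(\<And>n. s n \<in> A) \<Longrightarrow> (\<And>n. psd (s n)) \<Longrightarrow> (\<And>n. psd (id_blinfun - s n)) \<Longrightarrow>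
      (\<And>n. psd (s (Suc n) - s n)) \<Longrightarrow>
      (\<And>x. (\<lambda>n. blinfun_apply (s n) x) \<longlonglongrightarrow> blinfun_apply p x) \<Longrightarrow> p \<in> A"
begin

lemma diff_in: "a \<in> A \<Longrightarrow> b \<in> A \<Longrightarrow> a - b \<in> A"
  using add_in[of a "- 1 *\<^sub>R b"] scaleR_in[of b "-1"] by simp

lemmas algebra_in = id_in add_in diff_in scaleR_in compose_in

end

lemma commute_strong_limit:
  assumes "\<And>x. (\<lambda>n. blinfun_apply (b n) x) \<longlonglongrightarrow> blinfun_apply p x"
    and "\<And>n. b n o\<^sub>L c = c o\<^sub>L b n"
  shows "p o\<^sub>L c = c o\<^sub>L p"
proof (rule blinfun_eqI)
  fix x
  have "(\<lambda>n. blinfun_apply c (blinfun_apply (b n) x)) \<longlonglongrightarrow> blinfun_apply c (blinfun_apply p x)"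
    by (intro tendsto_intros assms(1))
  moreover have "blinfun_apply (b n) (blinfun_apply c x) = blinfun_apply c (blinfun_apply (b n) x)" for n
    using assms(2)[of n] by (metis blinfun_apply_blinfun_compose)
  ultimately have "(\<lambda>n. blinfun_apply (b n) (blinfun_apply c x)) \<longlonglongrightarrow> blinfun_apply c (blinfun_apply p x)"
    by simp
  then show "blinfun_apply (p o\<^sub>L c) x = blinfun_apply (c o\<^sub>L p) x"
    using LIMSEQ_unique[OF assms(1)[of "blinfun_apply c x"]] by simp
qed

lemma norm_tendsto_strong:
  "b \<longlonglongrightarrow> p \<Longrightarrow> (\<lambda>n. blinfun_apply (b n) x) \<longlonglongrightarrow> blinfun_apply p x"
  by (intro tendsto_intros)

lemma compose_inverse_commute:
  assumes "a o\<^sub>L b = id_blinfun" "b o\<^sub>L a = id_blinfun" "a o\<^sub>L c = c o\<^sub>L a"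
  shows "b o\<^sub>L c = c o\<^sub>L b"
  using assms by (metis compose_assoc compose_id)

text \<open>Working in this intersection keeps constructions from \<open>a\<close> inside
  \<open>A\<close> and commuting with everything that commutes with \<open>a\<close>, without
  forming a generated subalgebra.\<close>

lemma (in op_algebra) op_algebra_Int_bicommuting: "op_algebra (A \<inter> bicommuting a)"
proof
  show "closed (A \<inter> bicommuting a)"
    unfolding closed_sequential_limits
  proof (intro allI impI, elim conjE)
    fix b l assume b: "\<forall>n. b n \<in> A \<inter> bicommuting a" and l: "b \<longlonglongrightarrow> l"
    have "l \<in> A" using closed b l unfolding closed_sequential_limits by blast
    moreover have "l o\<^sub>L c = c o\<^sub>L l" if "a o\<^sub>L c = c o\<^sub>L a" for c
      using norm_tendsto_strong[OF l]
        by (rule commute_strong_limit) (use b that in \<open>simp add: bicommuting_def\<close>)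
    ultimately show "l \<in> A \<inter> bicommuting a" by (simp add: bicommuting_def)
  qed
next
  fix b p
  assume b: "\<And>n. b n \<in> A \<inter> bicommuting a" and h: "\<And>n. psd (b n)" "\<And>n. psd (id_blinfun - b n)"
      "\<And>n. psd (b (Suc n) - b n)"
      and l: "\<And>x. (\<lambda>n. blinfun_apply (b n) x) \<longlonglongrightarrow> blinfun_apply p x"
  have "p \<in> A" using monotone_limit_in[OF _ h l] b by blast
  moreover have "p o\<^sub>L c = c o\<^sub>L p" if "a o\<^sub>L c = c o\<^sub>L a" for c
    using l
        by (rule commute_strong_limit) (use b that in \<open>simp add: bicommuting_def\<close>)
  ultimately show "p \<in> A \<inter> bicommuting a" by (simp add: bicommuting_def)
next
  fix x y
  assume xy: "x \<in> A \<inter> bicommuting a" "x o\<^sub>L y = id_blinfun" "y o\<^sub>L x = id_blinfun"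
  then show "y \<in> A \<inter> bicommuting a"
    using inverse_in[OF _ xy(2,3)] compose_inverse_commute[OF xy(2,3)]
    unfolding bicommuting_def by blast
next
  fix x y
  assume xy: "x \<in> A \<inter> bicommuting a" "y \<in> A \<inter> bicommuting a"
  have "(x o\<^sub>L y) o\<^sub>L c = c o\<^sub>L (x o\<^sub>L y)" if "a o\<^sub>L c = c o\<^sub>L a" for c
  proof -
    have "x o\<^sub>L c = c o\<^sub>L x" "y o\<^sub>L c = c o\<^sub>L y"
      using xy that by (auto simp: bicommuting_def)
    then show ?thesis by (metis compose_assoc)
  qed
  then show "x o\<^sub>L y \<in> A \<inter> bicommuting a"
    using xy compose_in unfolding bicommuting_def by blast
next
  fix x y
  assume xy: "x \<in> A \<inter> bicommuting a" "y \<in> A \<inter> bicommuting a"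
  have "(x + y) o\<^sub>L c = c o\<^sub>L (x + y)" if "a o\<^sub>L c = c o\<^sub>L a" for c
    unfolding compose_bilinear using xy that by (simp add: bicommuting_def)
  then show "x + y \<in> A \<inter> bicommuting a"
    using xy add_in by (simp add: bicommuting_def)
next
  fix x r
  assume x: "x \<in> A \<inter> bicommuting a"
  have "(r *\<^sub>R x) o\<^sub>L c = c o\<^sub>L (r *\<^sub>R x)" if "a o\<^sub>L c = c o\<^sub>L a" for c
    unfolding compose_bilinear using x that by (simp add: bicommuting_def)
  then show "r *\<^sub>R x \<in> A \<inter> bicommuting a"
    using x scaleR_in by (simp add: bicommuting_def)
next
  show "id_blinfun \<in> A \<inter> bicommuting a"
    using id_in by (simp add: bicommuting_def)
qed

lemma bicommutingD: "b \<in> bicommuting a \<Longrightarrow> a o\<^sub>L c = c o\<^sub>L a \<Longrightarrow> b o\<^sub>L c = c o\<^sub>L b"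
  unfolding bicommuting_def by simp

text \<open>As \<open>a\<close> commutes with itself, \<open>c\<close> commutes with
  \<open>a\<close>; membership of \<open>b\<close> then makes \<open>b\<close> commute with
  \<open>c\<close>.\<close>

lemma bicommuting_commute:
  assumes "b \<in> bicommuting a" "c \<in> bicommuting a"
  shows "b o\<^sub>L c = c o\<^sub>L b"
proof -
  have "c o\<^sub>L a = a o\<^sub>L c" by (rule bicommutingD[OF assms(2) refl])
  from bicommutingD[OF assms(1) this[symmetric]] show ?thesis .
qed

lemma bicommuting_self: "a \<in> bicommuting a"
  unfolding bicommuting_def by simp

section \<open>Square roots of positive operators\<close>

text \<open>Coercivity buys a contraction constant below 1, so closedness in norm is enough. The
  lower bound \<open>d\<close> on the root makes the root invertible and lets the lemma be applied
  to it again.\<close>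

lemma (in op_algebra) coercive_square_root:
  assumes b: "b \<in> A" "sym_op b" and c: "0 < c"
    and coercive: "\<And>x. c * (norm x)\<^sup>2 \<le> inner (blinfun_apply b x) x"
  shows "\<exists>h d. h \<in> A \<and> psd h \<and> h o\<^sub>L h = b \<and> 0 < d \<and>
    (\<forall>x. d * (norm x)\<^sup>2 \<le> inner (blinfun_apply h x) x)"
proof -
  \<comment> \<open>Since \<open>K \<ge> norm b\<close>, the form of \<open>b / K\<close> on unit
    vectors lies between \<open>c / K\<close> and 1, so \<open>1 - b / K\<close> has norm at most
    \<open>r = 1 - c / K\<close>. Adding \<open>c\<close> makes \<open>K\<close> positive and
    \<open>r\<close> nonnegative.\<close>
  define K where "K = norm b + c"
  have K: "0 < K" "c \<le> K" using c by (auto simp: K_def add_nonneg_pos)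
  define r where "r = 1 - c / K"
  have r: "0 \<le> r" "r < 1" using K c by (auto simp: r_def)
  define x where "x = id_blinfun - (1 / K) *\<^sub>R b"
  have x: "x \<in> A" "sym_op x"
    unfolding x_def by (intro algebra_in b sym_op_diff sym_op_id sym_op_scaleR)+
  have normx: "norm x \<le> r"
  proof (rule sym_op_norm_le[OF x(2) r(1)])
    fix y
    have "inner (blinfun_apply b y) y \<le> norm (blinfun_apply b y) * norm y"
      by (rule norm_cauchy_schwarz)
    also have "\<dots> \<le> (norm b * norm y) * norm y"
      by (intro mult_right_mono norm_blinfun) simp
    also have "\<dots> \<le> K * (norm y)\<^sup>2"
      using c by (simp add: K_def power2_eq_square algebra_simps)
    finally have "inner (blinfun_apply b y) y / K \<le> (norm y)\<^sup>2"
      using K by (simp add: pos_divide_le_eq mult.commute)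
    moreover have "c / K * (norm y)\<^sup>2 \<le> inner (blinfun_apply b y) y / K"
      using coercive[of y] K by (simp add: divide_right_mono)
    moreover have "inner (blinfun_apply x y) y = (norm y)\<^sup>2 - inner (blinfun_apply b y) y / K"
      by (simp add: x_def op_simps power2_norm_eq_inner)
    ultimately show "\<bar>inner (blinfun_apply x y) y\<bar> \<le> r * (norm y)\<^sup>2"
      by (simp add: r_def algebra_simps)
  qed
  \<comment> \<open>With \<open>x = 1 - b/K\<close>, the root is \<open>\<surd>K (1 - y)\<close> for the fixed point \<open>y = 1 - \<surd>(1 - x)\<close> of
    \<open>y \<mapsto> (x + y\<^sup>2)/2\<close>, a contraction on the ball of radius \<open>r < 1\<close>.\<close>
  define S where "S = {y \<in> A. sym_op y \<and> norm y \<le> r}"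
  have "closed {y :: 'h \<Rightarrow>\<^sub>L 'h. sym_op y}"
    unfolding sym_op_def by (intro closed_Collect_all closed_Collect_eq continuous_intros)
  moreover have "closed {y :: 'h \<Rightarrow>\<^sub>L 'h. norm y \<le> r}"
    by (intro closed_Collect_le continuous_intros)
  moreover have "S = A \<inter> {y. sym_op y} \<inter> {y. norm y \<le> r}" by (auto simp: S_def)
  ultimately have "complete S" using closed by (simp add: complete_eq_closed closed_Int)
  have "\<exists>!y\<in>S. (1/2) *\<^sub>R (x + (y o\<^sub>L y)) = y"
  proof (rule Banach_fix[OF \<open>complete S\<close> _ r])
    show "S \<noteq> {}" using x normx by (auto simp: S_def)
    show "(\<lambda>y. (1/2) *\<^sub>R (x + (y o\<^sub>L y))) ` S \<subseteq> S"
    proof clarify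
      fix y assume "y \<in> S"
      then have y: "y \<in> A" "sym_op y" "norm y \<le> r" by (auto simp: S_def)
      have "norm (y o\<^sub>L y) \<le> r * r"
        using norm_blinfun_compose[of y y] y(3) mult_mono[OF y(3) y(3)] r(1) by simp
      also have "\<dots> \<le> r * 1" using r by (intro mult_left_mono) auto
      finally have "norm (x + (y o\<^sub>L y)) \<le> 2 * r"
        using normx norm_triangle_ineq[of x "y o\<^sub>L y"] by simp
      then show "(1/2) *\<^sub>R (x + (y o\<^sub>L y)) \<in> S"
        using x y by (simp add: S_def algebra_in sym_op_scaleR sym_op_add sym_op_square)
    qed
    fix y z assume "y \<in> S" "z \<in> S"
    then have yz: "norm y \<le> r" "norm z \<le> r" by (auto simp: S_def)
    \<comment> \<open>This splitting of the difference of the two squares is valid without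
      \<open>y\<close> and \<open>z\<close> commuting.\<close>
    have "(1/2) *\<^sub>R (x + (y o\<^sub>L y)) - (1/2) *\<^sub>R (x + (z o\<^sub>L z))
      = (1/2) *\<^sub>R ((y o\<^sub>L (y - z)) + ((y - z) o\<^sub>L z))"
      by (simp add: compose_bilinear flip: scaleR_diff_right)
    then have "dist ((1/2) *\<^sub>R (x + (y o\<^sub>L y))) ((1/2) *\<^sub>R (x + (z o\<^sub>L z)))
      = norm ((y o\<^sub>L (y - z)) + ((y - z) o\<^sub>L z)) / 2"
      by (simp add: dist_norm)
    also have "\<dots> \<le> (norm y * norm (y - z) + norm (y - z) * norm z) / 2"
      by (intro divide_right_mono norm_triangle_mono norm_blinfun_compose) simp
    also have "\<dots> \<le> (r * norm (y - z) + norm (y - z) * r) / 2"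
      using yz by (intro divide_right_mono add_mono mult_left_mono mult_right_mono) auto
    finally show "dist ((1/2) *\<^sub>R (x + (y o\<^sub>L y))) ((1/2) *\<^sub>R (x + (z o\<^sub>L z))) \<le> r * dist y z"
      by (simp add: dist_norm mult.commute)
  qed
  then obtain y where y: "y \<in> A" "sym_op y" "norm y \<le> r" "(1/2) *\<^sub>R (x + (y o\<^sub>L y)) = y"
    by (auto simp: S_def)
  have "x + (y o\<^sub>L y) = 2 *\<^sub>R ((1/2) *\<^sub>R (x + (y o\<^sub>L y)))" by simp
  then have yy: "y o\<^sub>L y = 2 *\<^sub>R y - x"
    unfolding y(4) by (simp add: algebra_simps)
  define h where "h = sqrt K *\<^sub>R (id_blinfun - y)"
  have "h o\<^sub>L h = K *\<^sub>R (id_blinfun - 2 *\<^sub>R y + (y o\<^sub>L y))"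
    using K by (simp add: h_def compose_bilinear scaleR_2 algebra_simps)
  also have "\<dots> = b" using K by (simp add: yy x_def)
  finally have hh: "h o\<^sub>L h = b" .
  have pos: "sqrt K * (1 - r) * (norm z)\<^sup>2 \<le> inner (blinfun_apply h z) z" for z
  proof -
    have "inner (blinfun_apply y z) z \<le> norm (blinfun_apply y z) * norm z"
      by (rule norm_cauchy_schwarz)
    also have "\<dots> \<le> (norm y * norm z) * norm z"
      by (intro mult_right_mono norm_blinfun) simp
    also have "\<dots> \<le> (r * norm z) * norm z"
      using y(3) by (intro mult_right_mono) auto
    finally have "(1 - r) * (norm z)\<^sup>2 \<le> inner (blinfun_apply (id_blinfun - y) z) z"
      by (simp add: op_simps power2_norm_eq_inner[symmetric] power2_eq_square algebra_simps)
    then have "sqrt K * ((1 - r) * (norm z)\<^sup>2) \<le> sqrt K * inner (blinfun_apply (id_blinfun - y) z) z"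
      using K by (intro mult_left_mono) auto
    then show ?thesis by (simp add: h_def op_simps mult.assoc)
  qed
  have "0 \<le> inner (blinfun_apply h z) z" for z
    by (rule order_trans[OF _ pos]) (use r K in auto)
  moreover have "h \<in> A" "sym_op h"
    unfolding h_def by (intro algebra_in y sym_op_diff sym_op_id sym_op_scaleR)+
  moreover have "0 < sqrt K * (1 - r)" using r K by simp
  ultimately show ?thesis
    using hh pos by (intro exI[of _ h] exI[of _ "sqrt K * (1 - r)"]) (simp add: psd_def)
qed

lemma psd_tendsto_norm: "(\<And>n. psd (b n)) \<Longrightarrow> b \<longlonglongrightarrow> p \<Longrightarrow> psd p"
  by (rule psd_tendsto[OF _ norm_tendsto_strong])

locale commutative_op_algebra = op_algebra +
  assumes commute: "a \<in> A \<Longrightarrow> b \<in> A \<Longrightarrow> a o\<^sub>L b = b o\<^sub>L a"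
begin

text \<open>Adding the scalar \<open>(e n)\<^sup>2\<close> makes \<open>b\<close> coercive. The
  resulting roots are Cauchy in norm: the product of \<open>P n + P m\<close> and
  \<open>P n - P m\<close> is the scalar \<open>(e n)\<^sup>2 - (e m)\<^sup>2\<close>, while
  \<open>P n + P m\<close> is bounded below by \<open>e n\<close>.\<close>

lemma square_root:
  assumes b: "b \<in> A" "psd b"
  obtains h where "h \<in> A" "psd h" "h o\<^sub>L h = b"
proof -
  define e where "e n = inverse (real (Suc n))" for n
  have e: "e n > 0" for n by (simp add: e_def)
  \<comment> \<open>The root \<open>R\<close> of \<open>P\<close> is recorded for the lower bound on
    \<open>P n + P m\<close>: if \<open>R\<close> is a root of \<open>P m\<close>, then
    commutativity gives \<open>inner (P n z) (P m z) = inner (P n (R z)) (R z)\<close>, which is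
    nonnegative.\<close>
  have "\<exists>P. P \<in> A \<and> psd P \<and> P o\<^sub>L P = b + (e n)\<^sup>2 *\<^sub>R id_blinfun \<and>
      (\<exists>R\<in>A. psd R \<and> R o\<^sub>L R = P)" for n
  proof -
    have co: "(e n)\<^sup>2 * (norm x)\<^sup>2 \<le> inner (blinfun_apply (b + (e n)\<^sup>2 *\<^sub>R id_blinfun) x) x" for x
      using psdD(2)[OF b(2), of x] by (simp add: op_simps power2_norm_eq_inner)
    have bA: "b + (e n)\<^sup>2 *\<^sub>R id_blinfun \<in> A" "sym_op (b + (e n)\<^sup>2 *\<^sub>R id_blinfun)"
      by (intro algebra_in b sym_op_add sym_op_scaleR sym_op_id psdD(1))+
    have e2: "0 < (e n)\<^sup>2" using e[of n] by simp
    obtain P d where P: "P \<in> A" "psd P" "P o\<^sub>L P = b + (e n)\<^sup>2 *\<^sub>R id_blinfun" "0 < d"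
      "\<And>x. d * (norm x)\<^sup>2 \<le> inner (blinfun_apply P x) x"
      using coercive_square_root[OF bA e2 co] by metis
    obtain R c where "R \<in> A" "psd R" "R o\<^sub>L R = P"
      using coercive_square_root[OF P(1) psdD(1)[OF P(2)] P(4,5)] by metis
    then show ?thesis using P by blast
  qed
  then have "\<forall>n. \<exists>P. P \<in> A \<and> psd P \<and> P o\<^sub>L P = b + (e n)\<^sup>2 *\<^sub>R id_blinfun \<and>
      (\<exists>R\<in>A. psd R \<and> R o\<^sub>L R = P)" by blast
  from choice[OF this] obtain P where P: "\<And>n. P n \<in> A" "\<And>n. psd (P n)"
    "\<And>n. P n o\<^sub>L P n = b + (e n)\<^sup>2 *\<^sub>R id_blinfun"
    "\<And>n. \<exists>R\<in>A. psd R \<and> R o\<^sub>L R = P n" by blast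
  have lower: "e n * norm z \<le> norm (blinfun_apply (P n + P m) z)" for n m z
  proof -
    obtain R where R: "R \<in> A" "psd R" "R o\<^sub>L R = P m" using P(4) by blast
    have "inner (blinfun_apply (P n) z) (blinfun_apply (P m) z)
      = inner (blinfun_apply R (blinfun_apply (P n) z)) (blinfun_apply R z)"
      using sym_opD[OF psdD(1)[OF R(2)], of "blinfun_apply (P n) z" "blinfun_apply R z"]
      by (simp flip: R(3))
    also have "\<dots> = inner (blinfun_apply (P n) (blinfun_apply R z)) (blinfun_apply R z)"
      using commute[OF R(1) P(1)[of n]] by (metis blinfun_apply_blinfun_compose)
    finally have cross: "0 \<le> inner (blinfun_apply (P n) z) (blinfun_apply (P m) z)"
      using psdD(2)[OF P(2)] by simp
    have "inner (blinfun_apply (P n) z) (blinfun_apply (P n) z) = inner (blinfun_apply (P n o\<^sub>L P n) z) z"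
      using sym_opD[OF psdD(1)[OF P(2)[of n]], of "blinfun_apply (P n) z" z] by simp
    also have "\<dots> \<ge> (e n)\<^sup>2 * (norm z)\<^sup>2"
      unfolding P(3) using psdD(2)[OF b(2), of z] by (simp add: op_simps power2_norm_eq_inner)
    finally have "(e n)\<^sup>2 * (norm z)\<^sup>2 \<le> inner (blinfun_apply (P n) z) (blinfun_apply (P n) z)" .
    moreover have "(norm (blinfun_apply (P n + P m) z))\<^sup>2
      = inner (blinfun_apply (P n) z) (blinfun_apply (P n) z)
        + 2 * inner (blinfun_apply (P n) z) (blinfun_apply (P m) z)
        + inner (blinfun_apply (P m) z) (blinfun_apply (P m) z)"
      by (simp add: power2_norm_eq_inner op_simps inner_commute)
    ultimately have "(e n * norm z)\<^sup>2 \<le> (norm (blinfun_apply (P n + P m) z))\<^sup>2"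
      using cross inner_ge_zero[of "blinfun_apply (P m) z"] unfolding power_mult_distrib by linarith
    then show ?thesis by (rule power2_le_imp_le) simp
  qed
  have dist: "norm (P n - P m) \<le> e n" if "n \<le> m" for n m
  proof (rule norm_blinfun_bound)
    fix x
    have em: "e m \<le> e n" using that unfolding e_def by (intro le_imp_inverse_le) auto
    have "(P n + P m) o\<^sub>L (P n - P m) = (P n o\<^sub>L P n) - (P m o\<^sub>L P m)"
      unfolding compose_bilinear commute[OF P(1)[of m] P(1)[of n]] by simp
    also have "\<dots> = ((e n)\<^sup>2 - (e m)\<^sup>2) *\<^sub>R id_blinfun"
      by (simp add: P(3) algebra_simps)
    finally have "e n * norm (blinfun_apply (P n - P m) x)
      \<le> norm (blinfun_apply (((e n)\<^sup>2 - (e m)\<^sup>2) *\<^sub>R id_blinfun) x)"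
      using lower[of n "blinfun_apply (P n - P m) x" m] by (metis blinfun_apply_blinfun_compose)
    also have "\<dots> = \<bar>(e n)\<^sup>2 - (e m)\<^sup>2\<bar> * norm x" by (simp add: op_simps)
    also have "\<dots> \<le> e n * (e n * norm x)"
    proof -
      have "(e m)\<^sup>2 \<le> (e n)\<^sup>2" using em e[of m] by (intro power_mono) auto
      then have "\<bar>(e n)\<^sup>2 - (e m)\<^sup>2\<bar> \<le> e n * e n"
        by (simp add: power2_eq_square)
      then show ?thesis by (metis mult.assoc mult_right_mono norm_ge_zero)
    qed
    finally show "norm (blinfun_apply (P n - P m) x) \<le> e n * norm x"
      using e[of n] by simp
  qed (use e[of n] in simp)
  have "Cauchy P"
  proof (rule CauchyI')
    fix r :: real assume "0 < r"
    then obtain N where N: "e N < r" using reals_Archimedean[of r] by (auto simp: e_def)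
    show "\<exists>M. \<forall>m\<ge>M. \<forall>n>m. dist (P m) (P n) < r"
      unfolding dist_norm
    proof (intro exI allI impI)
      fix m n assume "N \<le> m" "m < n"
      have "e m \<le> e N" using \<open>N \<le> m\<close> unfolding e_def by (intro le_imp_inverse_le) auto
      then show "norm (P m - P n) < r" using dist[of m n] \<open>m < n\<close> N by simp
    qed
  qed
  then have "convergent P" by (rule Cauchy_convergent)
  then obtain h where h: "P \<longlonglongrightarrow> h" using convergentD by blast
  have "h \<in> A" using closed_sequentially[OF closed P(1) h] .
  moreover have "psd h" using psd_tendsto_norm[OF P(2) h] .
  moreover have "h o\<^sub>L h = b"
  proof (rule LIMSEQ_unique)
    show "(\<lambda>n. P n o\<^sub>L P n) \<longlonglongrightarrow> (h o\<^sub>L h)"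
      by (rule bounded_bilinear.tendsto[OF bounded_bilinear_blinfun_compose h h])
    have e0: "e \<longlonglongrightarrow> 0" unfolding e_def by (rule LIMSEQ_inverse_real_of_nat)
    have "(\<lambda>n. b + (e n)\<^sup>2 *\<^sub>R id_blinfun) \<longlonglongrightarrow> b + 0\<^sup>2 *\<^sub>R id_blinfun"
      by (intro tendsto_add tendsto_scaleR tendsto_power tendsto_const e0)
    then show "(\<lambda>n. P n o\<^sub>L P n) \<longlonglongrightarrow> b" by (simp add: P(3))
  qed
  ultimately show thesis by (rule that)
qed

end

section \<open>Kernel projections and signs\<close>

lemma (in commutative_op_algebra) kernel_projection:
  assumes b: "b \<in> A" "sym_op b"
  obtains q where "q \<in> A" "sym_op q" "q o\<^sub>L q = q" "b o\<^sub>L q = 0"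
    "\<And>x. blinfun_apply b x = 0 \<Longrightarrow> blinfun_apply q x = x"
proof -
  \<comment> \<open>Squaring makes the operator positive without changing its kernel, as
    \<open>Tb\<close> shows.\<close>
  define T where "T = b o\<^sub>L b"
  have T: "psd T" "T \<in> A" unfolding T_def by (intro psd_square compose_in b)+
  have Tb: "inner (blinfun_apply T x) x = (norm (blinfun_apply b x))\<^sup>2" for x
    using sym_opD[OF b(2), of "blinfun_apply b x" x] by (simp add: T_def power2_norm_eq_inner)
  note symT = sym_opD[OF psdD(1)[OF T(1)]]
  \<comment> \<open>The projection is the decreasing limit of \<open>(1 + n b\<^sup>2)\<^sup>-\<^sup>1\<close>.\<close>
  define R where "R n = id_blinfun + real n *\<^sub>R T" for n
  have R: "blinfun_apply (R n) x = x + real n *\<^sub>R blinfun_apply T x" for n x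
    by (simp add: R_def op_simps)
  have RA: "R n \<in> A" for n unfolding R_def by (intro algebra_in T)
  have "psd (R n)" for n unfolding R_def by (intro psd_add psd_id psd_scaleR T) simp
  then have symR: "inner (blinfun_apply (R n) x) y = inner x (blinfun_apply (R n) y)" for n x y
    using psdD(1) sym_opD by blast
  have "\<exists>q. R n o\<^sub>L q = id_blinfun \<and> q o\<^sub>L R n = id_blinfun" for n
  proof (rule coercive_invertible[of 1])
    show "1 * (norm x)\<^sup>2 \<le> inner (blinfun_apply (R n) x) x" for x
      using psdD(2)[OF T(1), of x] by (simp add: R op_simps power2_norm_eq_inner)
  qed simp
  then have "\<forall>n. \<exists>q. R n o\<^sub>L q = id_blinfun \<and> q o\<^sub>L R n = id_blinfun" by simp
  from choice[OF this] obtain q where q: "\<And>n. R n o\<^sub>L q n = id_blinfun" "\<And>n. q n o\<^sub>L R n = id_blinfun"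
    by blast
  have qA: "q n \<in> A" for n using inverse_in[OF RA q(1,2)] .
  have Rq: "blinfun_apply (R n) (blinfun_apply (q n) x) = x"
    and qR: "blinfun_apply (q n) (blinfun_apply (R n) x) = x" for n x
    using q[of n] by (metis blinfun_apply_blinfun_compose blinfun_apply_id_blinfun)+
  have symq: "sym_op (q n)" for n
    unfolding sym_op_def
  proof (intro allI)
    fix x y
    have "inner (blinfun_apply (q n) x) y
      = inner (blinfun_apply (q n) x) (blinfun_apply (R n) (blinfun_apply (q n) y))"
      by (simp add: Rq)
    also have "\<dots> = inner x (blinfun_apply (q n) y)"
      unfolding symR[symmetric] by (simp add: Rq)
    finally show "inner (blinfun_apply (q n) x) y = inner x (blinfun_apply (q n) y)" .
  qed
  have psdq: "psd (q n)" for n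
  proof -
    have "0 \<le> inner (blinfun_apply (q n) x) x" for x
    proof -
      define z where "z = blinfun_apply (q n) x"
      have "x = blinfun_apply (R n) z" by (simp add: z_def Rq)
      then show ?thesis
        using psdD(2)[OF T(1), of z] by (simp add: qR) (simp add: R op_simps inner_commute)
    qed
    then show ?thesis using symq by (simp add: psd_def)
  qed
  \<comment> \<open>Closure under monotone limits concerns increasing sequences, hence the passage
    to complements.\<close>
  define p where "p n = id_blinfun - q n" for n
  have pA: "p n \<in> A" for n unfolding p_def by (intro algebra_in qA)
  have psdp: "psd (p n)" for n
  proof -
    have "0 \<le> inner (blinfun_apply (p n) x) x" for x
    proof -
      define z where "z = blinfun_apply (q n) x"
      have x: "x = blinfun_apply (R n) z" by (simp add: z_def Rq)
      have "blinfun_apply (p n) x = real n *\<^sub>R blinfun_apply T z"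
        by (simp add: p_def op_simps x qR) (simp add: R)
      then show ?thesis
        using psdD(2)[OF T(1), of z] by (simp add: x R op_simps)
    qed
    then show ?thesis using symq by (simp add: psd_def p_def sym_op_diff sym_op_id)
  qed
  have mono: "psd (p (Suc n) - p n)" for n
  proof -
    have "0 \<le> inner (blinfun_apply (p (Suc n) - p n) x) x" for x
    proof -
      \<comment> \<open>With this \<open>z\<close>, \<open>x = R n (R (Suc n) z)\<close> and the
        difference of the two \<open>p\<close> sends \<open>x\<close> to \<open>T z\<close>. The
        form becomes that of \<open>T z\<close> against
        \<open>z + (2 n + 1) T z + n (n + 1) T (T z)\<close>, and each of the three terms is
        nonnegative.\<close>
      define z where "z = blinfun_apply (q (Suc n)) (blinfun_apply (q n) x)"
      have x: "x = blinfun_apply (R n) (blinfun_apply (R (Suc n)) z)" by (simp add: z_def Rq)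
      have x': "x = blinfun_apply (R (Suc n)) (blinfun_apply (R n) z)"
        unfolding x by (simp add: R op_simps algebra_simps)
      have "blinfun_apply (q n) x = blinfun_apply (R (Suc n)) z" unfolding x by (rule qR)
      moreover have "blinfun_apply (q (Suc n)) x = blinfun_apply (R n) z" unfolding x' by (rule qR)
      ultimately have d: "blinfun_apply (p (Suc n) - p n) x = blinfun_apply T z"
        by (simp add: p_def op_simps) (simp add: R op_simps algebra_simps)
      have "0 \<le> inner (blinfun_apply T z) z" "0 \<le> inner (blinfun_apply T z) (blinfun_apply T z)"
        "0 \<le> inner (blinfun_apply T z) (blinfun_apply T (blinfun_apply T z))"
        using psdD(2)[OF T(1)] by (simp_all add: inner_commute)
      then show ?thesis unfolding d unfolding x by (simp add: R op_simps)
    qed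
    moreover have "sym_op (p (Suc n) - p n)" using psdp psdD(1) sym_op_diff by blast
    ultimately show ?thesis by (simp add: psd_def)
  qed
  have psd1p: "psd (id_blinfun - p n)" for n using psdq by (simp add: p_def)
  from monotone_psd_limit[where b = p, OF psdp psd1p mono] obtain P
    where P: "\<And>x. (\<lambda>n. blinfun_apply (p n) x) \<longlonglongrightarrow> blinfun_apply P x" by blast
  have PA: "P \<in> A" by (rule monotone_limit_in[where s = p, OF pA psdp psd1p mono P])
  define Q where "Q = id_blinfun - P"
  have QA: "Q \<in> A" unfolding Q_def by (intro algebra_in PA)
  have Q: "(\<lambda>n. blinfun_apply (q n) x) \<longlonglongrightarrow> blinfun_apply Q x" for x
    using tendsto_diff[OF tendsto_const[of x] P[of x]] by (simp add: p_def Q_def op_simps)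
  have symQ: "sym_op Q" using psd_tendsto[where b = q, OF psdq Q] psdD(1) by blast
  have fix_kernel: "blinfun_apply Q x = x" if "blinfun_apply b x = 0" for x
  proof -
    have "blinfun_apply (R n) x = x" for n by (simp add: R T_def that)
    then have "blinfun_apply (q n) x = x" for n using qR[of n x] by simp
    then show ?thesis using LIMSEQ_unique[OF Q[of x]] by simp
  qed
  \<comment> \<open>Since \<open>n T (q n x) = p n x\<close> and \<open>p n\<close> has norm at most
    1, the vectors \<open>T (q n x)\<close> are of order \<open>1 / n\<close>.\<close>
  have TQ: "blinfun_apply T (blinfun_apply Q x) = 0" for x
  proof (rule LIMSEQ_unique)
    show "(\<lambda>n. blinfun_apply T (blinfun_apply (q n) x)) \<longlonglongrightarrow> blinfun_apply T (blinfun_apply Q x)"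
      by (intro tendsto_intros Q)
    have bound: "norm (p n) \<le> 1" for n
    proof (rule sym_op_norm_le)
      show "\<bar>inner (blinfun_apply (p n) x) x\<bar> \<le> 1 * (norm x)\<^sup>2" for x
        using psdD(2)[OF psdp, of n x] psdD(2)[OF psd1p, of n x]
        by (simp add: op_simps power2_norm_eq_inner)
    qed (use psdp psdD(1) in auto)
    have "norm (blinfun_apply T (blinfun_apply (q n) x)) \<le> norm x / real n" if "n \<ge> 1" for n
    proof -
      have "real n *\<^sub>R blinfun_apply T (blinfun_apply (q n) x) = blinfun_apply (p n) x"
        using Rq[of n x] by (simp add: p_def op_simps R algebra_simps)
      then have "real n * norm (blinfun_apply T (blinfun_apply (q n) x)) = norm (blinfun_apply (p n) x)"
        by (metis abs_of_nat norm_scaleR)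
      also have "\<dots> \<le> norm (p n) * norm x" by (rule norm_blinfun)
      also have "\<dots> \<le> norm x" using bound[of n] mult_right_mono[of "norm (p n)" 1 "norm x"] by simp
      finally show ?thesis using that by (simp add: field_simps)
    qed
    then show "(\<lambda>n. blinfun_apply T (blinfun_apply (q n) x)) \<longlonglongrightarrow> 0"
      by (intro Lim_null_comparison[OF _ lim_const_over_n[of "norm x"]] eventually_sequentiallyI[of 1]) simp
  qed
  have bQ: "blinfun_apply b (blinfun_apply Q x) = 0" for x
    using Tb[of "blinfun_apply Q x"] by (simp add: TQ)
  have "Q o\<^sub>L Q = Q" by (rule blinfun_eqI) (simp add: fix_kernel bQ)
  moreover have "b o\<^sub>L Q = 0" by (rule blinfun_eqI) (simp add: bQ)
  ultimately show thesis using that[OF QA symQ _ _ fix_kernel] by simp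
qed

lemma (in op_algebra) sign_decomposition:
  assumes a: "a \<in> A" "sym_op a"
  obtains s where "s \<in> A \<inter> bicommuting a" "sym_op s" "s o\<^sub>L s = id_blinfun" "psd (s o\<^sub>L a)"
proof -
  interpret B: op_algebra "A \<inter> bicommuting a" by (rule op_algebra_Int_bicommuting)
  interpret B: commutative_op_algebra "A \<inter> bicommuting a"
    by unfold_locales (use bicommuting_commute in blast)
  have aB: "a \<in> A \<inter> bicommuting a" using a bicommuting_self by blast
  obtain h where h: "h \<in> A \<inter> bicommuting a" "psd h" "h o\<^sub>L h = a o\<^sub>L a"
    using B.square_root[OF B.compose_in[OF aB aB] psd_square[OF a(2)]] by metis
  \<comment> \<open>\<open>h = |a|\<close>, and \<open>s\<close> is \<open>-1\<close> on the kernel of \<open>|a| + a\<close> and \<open>1\<close> on its complement.\<close>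
  define b where "b = h + a"
  have b: "b \<in> A \<inter> bicommuting a" "sym_op b"
    unfolding b_def by (intro B.algebra_in h aB sym_op_add a psdD(1))+
  obtain q where q: "q \<in> A \<inter> bicommuting a" "sym_op q" "q o\<^sub>L q = q" "b o\<^sub>L q = 0"
    "\<And>x. blinfun_apply b x = 0 \<Longrightarrow> blinfun_apply q x = x"
    using B.kernel_projection[OF b] by metis
  \<comment> \<open>Commutation makes \<open>(h + a) (h - a) = 0\<close>, so the range of
    \<open>h - a\<close> lies in the kernel of \<open>b\<close>, where \<open>q\<close> is the
    identity; \<open>q\<close> also annihilates the range of \<open>h + a\<close>. Subtracting gives
    \<open>2 q a = a - h\<close>, that is \<open>s a = h\<close>.\<close>
  have "b o\<^sub>L (h - a) = (h o\<^sub>L h) - (a o\<^sub>L a)"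
    unfolding b_def compose_bilinear B.commute[OF aB h(1)] by simp
  then have "blinfun_apply b (blinfun_apply (h - a) x) = 0" for x
    by (metis blinfun_apply_blinfun_compose blinfun.zero_left diff_self h(3))
  then have qc: "blinfun_apply q (blinfun_apply (h - a) x) = blinfun_apply (h - a) x" for x
    by (rule q(5))
  have qb: "blinfun_apply q (blinfun_apply (h + a) x) = 0" for x
    using B.commute[OF b(1) q(1)] q(4) unfolding b_def
    by (metis blinfun_apply_blinfun_compose blinfun.zero_left)
  define s where "s = id_blinfun - 2 *\<^sub>R q"
  have "blinfun_apply q (blinfun_apply q x) = blinfun_apply q x" for x
    using q(3) by (metis blinfun_apply_blinfun_compose)
  then have "s o\<^sub>L s = id_blinfun"
    by (intro blinfun_eqI) (simp add: s_def op_simps scaleR_2)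
  moreover have "s o\<^sub>L a = h"
  proof (rule blinfun_eqI)
    fix x
    have "2 *\<^sub>R blinfun_apply q (blinfun_apply a x)
      = blinfun_apply q (blinfun_apply (h + a) x) - blinfun_apply q (blinfun_apply (h - a) x)"
      by (simp add: op_simps scaleR_2)
    also have "\<dots> = blinfun_apply a x - blinfun_apply h x" unfolding qb qc by (simp add: op_simps)
    finally show "blinfun_apply (s o\<^sub>L a) x = blinfun_apply h x" by (simp add: s_def op_simps)
  qed
  moreover have "s \<in> A \<inter> bicommuting a" "sym_op s"
    unfolding s_def by (intro B.algebra_in q sym_op_diff sym_op_id sym_op_scaleR)+
  ultimately show thesis using that h(2) by metis
qed

section \<open>Connectedness of the invertible group\<close>

text \<open>The complex inner product is recovered from the real one and multiplication by
  \<open>\<i>\<close>; all translations between real and complex notions of adjoint and positivity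
  rest on this.\<close>

lemma Im_cinner: "Im (cinner x y) = inner x (\<i> *\<^sub>C y)"
proof -
  have eq: "cinner x (\<i> *\<^sub>C y) = - \<i> * cinner x y"
    by (metis cinner_commute cinner_cscale_left complex_cnj_i complex_cnj_mult)
  show ?thesis unfolding inner_eq_Re_cinner eq by simp
qed

lemma inner_ii_left: "inner (\<i> *\<^sub>C x) y = - inner x (\<i> *\<^sub>C y)"
  unfolding Im_cinner[symmetric] by (simp add: inner_eq_Re_cinner cinner_cscale_left)

lemma is_adjoint_iff_inner:
  assumes "b \<in> bounded_ops"
  shows "is_adjoint a b \<longleftrightarrow> (\<forall>x y. inner (blinfun_apply a x) y = inner x (blinfun_apply b y))"
proof
  assume "is_adjoint a b"
  then show "\<forall>x y. inner (blinfun_apply a x) y = inner x (blinfun_apply b y)"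
    by (simp add: is_adjoint_def inner_eq_Re_cinner)
next
  assume *: "\<forall>x y. inner (blinfun_apply a x) y = inner x (blinfun_apply b y)"
  have "Im (cinner (blinfun_apply a x) y) = Im (cinner x (blinfun_apply b y))" for x y
    using * assms by (simp add: Im_cinner bounded_ops_def)
  moreover have "Re (cinner (blinfun_apply a x) y) = Re (cinner x (blinfun_apply b y))" for x y
    using * by (simp flip: inner_eq_Re_cinner)
  ultimately show "is_adjoint a b"
    by (simp add: is_adjoint_def complex_eq_iff)
qed

lemma is_adjoint_self_iff: "a \<in> bounded_ops \<Longrightarrow> is_adjoint a a \<longleftrightarrow> sym_op a"
  by (simp add: is_adjoint_iff_inner sym_op_def)

text \<open>Over the complex numbers positivity forces symmetry: the form is real, so
  \<open>inner (a x) (\<i> x)\<close> vanishes, and polarising this identity gives symmetry.\<close>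

lemma positive_op_iff_psd:
  assumes a: "a \<in> bounded_ops"
  shows "positive_op a \<longleftrightarrow> psd a"
proof
  assume pos: "positive_op a"
  have re: "0 \<le> inner (blinfun_apply a x) x" and im: "inner (blinfun_apply a x) (\<i> *\<^sub>C x) = 0" for x
    using pos unfolding Im_cinner[symmetric]
    by (auto simp: positive_op_def complex_nonneg_Reals_iff inner_eq_Re_cinner)
  have "inner (blinfun_apply a x) y = inner x (blinfun_apply a y)" for x y
  proof -
    \<comment> \<open>Every \<open>y\<close> has the form \<open>\<i> z\<close>, which is how the
      polarised identity at \<open>x + z\<close> speaks about \<open>y\<close>.\<close>
    define z where "z = (- \<i>) *\<^sub>C y"
    have y: "y = \<i> *\<^sub>C z"
      using cscale_of_real[of 1 y] by (simp add: z_def cscale_cscale)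
    have "inner (blinfun_apply a x) (\<i> *\<^sub>C z) + inner (blinfun_apply a z) (\<i> *\<^sub>C x) = 0"
      using im[of "x + z"] im[of x] im[of z] by (simp add: op_simps cscale_add_right)
    moreover have "inner (blinfun_apply a z) (\<i> *\<^sub>C x) = - inner x (blinfun_apply a y)"
      using inner_ii_left[of "blinfun_apply a z" x] a
      by (simp add: y bounded_ops_def inner_commute)
    ultimately show ?thesis by (simp add: y)
  qed
  then show "psd a" using re by (simp add: psd_def sym_op_def)
next
  assume p: "psd a"
  have "inner (blinfun_apply a x) (\<i> *\<^sub>C x) = 0" for x
    using sym_opD[OF psdD(1)[OF p], of x "\<i> *\<^sub>C x"] inner_ii_left[of x "blinfun_apply a x"] a
    by (simp add: bounded_ops_def inner_commute)
  then show "positive_op a"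
    using psdD(2)[OF p]
    by (simp add: positive_op_def complex_nonneg_Reals_iff Im_cinner flip: inner_eq_Re_cinner)
qed

lemma Units_op_monoid:
  "Units (op_monoid A) = {a \<in> A. \<exists>b\<in>A. a o\<^sub>L b = id_blinfun \<and> b o\<^sub>L a = id_blinfun}"
  by (auto simp: Units_def op_monoid_def)

lemma connected_component_segment:
  fixes a b :: "'a::real_normed_vector"
  assumes "\<And>t. 0 \<le> t \<Longrightarrow> t \<le> 1 \<Longrightarrow> (1 - t) *\<^sub>R a + t *\<^sub>R b \<in> S"
  shows "connected_component S a b"
  unfolding connected_component_def
proof (intro exI conjI)
  show "closed_segment a b \<subseteq> S" using assms by (auto simp: closed_segment_def)
qed auto

section \<open>Paths in the invertible group\<close>

text \<open>A common interface for \<open>M\<close>, \<open>N\<close> and the centralizer, so that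
  connectedness is proved once for both factors of the product group.\<close>

locale star_op_algebra = op_algebra A for A :: "('h::chilbert_space \<Rightarrow>\<^sub>L 'h) set" +
  assumes complex_linear: "A \<subseteq> bounded_ops"
    and cscale_in: "a \<in> A \<Longrightarrow> cscale_op c a \<in> A"
    and adjoint_in: "a \<in> A \<Longrightarrow> \<exists>b\<in>A. is_adjoint a b"
begin

lemma Units_op_monoidI:
  "a \<in> A \<Longrightarrow> a o\<^sub>L b = id_blinfun \<Longrightarrow> b o\<^sub>L a = id_blinfun \<Longrightarrow> a \<in> Units (op_monoid A)"
  using inverse_in by (auto simp: Units_op_monoid)

lemma coercive_Units:
  assumes "a \<in> A" "0 < c" "\<And>x. c * (norm x)\<^sup>2 \<le> inner (blinfun_apply a x) x"
  shows "a \<in> Units (op_monoid A)"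
  using coercive_invertible[OF assms(2,3)] Units_op_monoidI[OF assms(1)] by blast

lemma compose_Units:
  assumes "a \<in> Units (op_monoid A)" "b \<in> Units (op_monoid A)"
  shows "a o\<^sub>L b \<in> Units (op_monoid A)"
proof -
  obtain a' b' where ab: "a \<in> A" "b \<in> A" "a o\<^sub>L a' = id_blinfun" "a' o\<^sub>L a = id_blinfun"
    "b o\<^sub>L b' = id_blinfun" "b' o\<^sub>L b = id_blinfun"
    using assms by (auto simp: Units_op_monoid)
  have "(a o\<^sub>L b) o\<^sub>L (b' o\<^sub>L a') = id_blinfun" "(b' o\<^sub>L a') o\<^sub>L (a o\<^sub>L b) = id_blinfun"
    using ab by (metis compose_assoc compose_id)+
  then show ?thesis using Units_op_monoidI[OF compose_in[OF ab(1,2)]] by blast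
qed

lemma inner_adjoint:
  assumes "a \<in> A"
  obtains b where "b \<in> A" "\<And>x y. inner (blinfun_apply a x) y = inner x (blinfun_apply b y)"
  using adjoint_in[OF assms] complex_linear is_adjoint_iff_inner by (metis subsetD)

lemma symmetry_connected_to_id:
  assumes s: "s \<in> A" "s o\<^sub>L s = id_blinfun"
  shows "connected_component (Units (op_monoid A)) s id_blinfun"
proof -
  define p where "p = (1/2) *\<^sub>R (id_blinfun + s)"
  define q where "q = (1/2) *\<^sub>R (id_blinfun - s)"
  have pq: "p \<in> A" "q \<in> A" unfolding p_def q_def by (intro algebra_in s)+
  have ss: "blinfun_apply s (blinfun_apply s x) = x" for x
    using s(2) by (metis blinfun_apply_blinfun_compose blinfun_apply_id_blinfun)
  have p: "blinfun_apply p (blinfun_apply p x) = blinfun_apply p x"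
    "blinfun_apply p (blinfun_apply q x) = 0"
    "blinfun_apply q (blinfun_apply q x) = blinfun_apply q x"
    "blinfun_apply q (blinfun_apply p x) = 0"
    "blinfun_apply p x + blinfun_apply q x = x" for x
    by (simp_all add: p_def q_def op_simps ss algebra_simps flip: scaleR_add_left)
  have complex: "blinfun_apply a (c *\<^sub>C x) = c *\<^sub>C blinfun_apply a x" if "a \<in> A" for a c x
    using that complex_linear by (auto simp: bounded_ops_def)
  \<comment> \<open>\<open>s = p - q\<close> with complementary projections; rotate the coefficient of \<open>q\<close>
    from \<open>-1\<close> through \<open>\<i>\<close> to \<open>1\<close>.\<close>
  define f where "f c = p + cscale_op c q" for c
  have f: "blinfun_apply (f c) x = blinfun_apply p x + c *\<^sub>C blinfun_apply q x" for c x
    by (simp add: f_def blinfun.add_left cscale_op.rep_eq)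
  have c0: "c *\<^sub>C (0::'h) = 0" for c
    using cscale_add_right[of c 0 0] by simp
  have c1: "1 *\<^sub>C (x::'h) = x" for x
    using cscale_of_real[of 1 x] by simp
  have fA: "f c \<in> A" for c unfolding f_def by (intro add_in pq cscale_in)
  have f_comp: "f c o\<^sub>L f d = id_blinfun" if "c * d = 1" for c d
    by (rule blinfun_eqI)
      (simp add: f blinfun.add_right complex pq p c0 c1 cscale_cscale that)
  have fU: "f c \<in> Units (op_monoid A)" if "c \<noteq> 0" for c
    using Units_op_monoidI[OF fA f_comp[of c "inverse c"] f_comp[of "inverse c" c]] that by simp
  \<comment> \<open>Being affine, \<open>f\<close> maps chords to segments, and the chords from -1
    to \<open>\<i>\<close> and from \<open>\<i>\<close> to 1 avoid 0; \<open>f c\<close> is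
    invertible for nonzero \<open>c\<close>.\<close>
  have line: "(1 - t) *\<^sub>R f c + t *\<^sub>R f d = f (of_real (1 - t) * c + of_real t * d)" for t c d
    by (rule blinfun_eqI)
      (simp only: blinfun.add_left blinfun.scaleR_left f cscale_of_real[symmetric] cscale_add_left
        cscale_add_right cscale_cscale[symmetric],
       simp add: algebra_simps cscale_of_real flip: cscale_add_left of_real_diff scaleR_add_left)
  have "connected_component (Units (op_monoid A)) (f (-1)) (f \<i>)"
    by (rule connected_component_segment) (auto simp: line complex_eq_iff intro!: fU)
  moreover have "connected_component (Units (op_monoid A)) (f \<i>) (f 1)"
    by (rule connected_component_segment) (auto simp: line complex_eq_iff intro!: fU)
  moreover have "f 1 = id_blinfun"
    by (rule blinfun_eqI) (simp add: f p c1)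
  moreover have "f (-1) = s"
  proof (rule blinfun_eqI)
    fix x
    have "(-1) *\<^sub>C y = - y" for y :: 'h using cscale_of_real[of "-1" y] by simp
    then show "blinfun_apply (f (-1)) x = blinfun_apply s x"
      by (simp add: f p_def q_def op_simps algebra_simps flip: scaleR_add_left)
  qed
  ultimately show ?thesis by (metis connected_component_trans)
qed

lemma unitary_connected_to_symmetry:
  assumes u: "u \<in> A" "v \<in> A" "u o\<^sub>L v = id_blinfun" "v o\<^sub>L u = id_blinfun"
    and adj: "\<And>x y. inner (blinfun_apply u x) y = inner x (blinfun_apply v y)"
  obtains s where "s \<in> A" "s o\<^sub>L s = id_blinfun" "connected_component (Units (op_monoid A)) s u"
proof -
  define a where "a = (1/2) *\<^sub>R (u + v)"
  have adj': "inner (blinfun_apply v x) y = inner x (blinfun_apply u y)" for x y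
    using adj[of y x] by (simp add: inner_commute)
  have a: "a \<in> A" "sym_op a"
    unfolding a_def sym_op_def by (intro algebra_in u, simp add: op_simps adj adj')
  obtain s where s: "s \<in> A \<inter> bicommuting a" "sym_op s" "s o\<^sub>L s = id_blinfun" "psd (s o\<^sub>L a)"
    using sign_decomposition[OF a] by metis
  \<comment> \<open>\<open>u\<close> commutes with its adjoint \<open>v\<close>, hence with
    \<open>a\<close>, and the bicommutant property carries this over to \<open>s\<close>.\<close>
  have "a o\<^sub>L u = u o\<^sub>L a"
    unfolding a_def compose_bilinear u(3,4) ..
  then have "s o\<^sub>L u = u o\<^sub>L s" using s(1) bicommutingD by blast
  then have su: "blinfun_apply s (blinfun_apply u x) = blinfun_apply u (blinfun_apply s x)" for x
    by (metis blinfun_apply_blinfun_compose)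
  have ss: "blinfun_apply s (blinfun_apply s x) = x" for x
    using s(3) by (metis blinfun_apply_blinfun_compose blinfun_apply_id_blinfun)
  \<comment> \<open>The adjoint of \<open>s v\<close> is \<open>u s = s u\<close>, so
    \<open>s u\<close> and \<open>s v\<close> have the same real quadratic form; their mean is
    \<open>s a\<close>, which is nonnegative.\<close>
  have re: "0 \<le> inner (blinfun_apply (s o\<^sub>L u) x) x" for x
  proof -
    have "inner (blinfun_apply (s o\<^sub>L v) x) x = inner (blinfun_apply v x) (blinfun_apply s x)"
      using sym_opD[OF s(2)] by simp
    also have "\<dots> = inner x (blinfun_apply (s o\<^sub>L u) x)" by (simp add: adj' su)
    finally have "inner (blinfun_apply (s o\<^sub>L v) x) x = inner (blinfun_apply (s o\<^sub>L u) x) x"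
      by (simp add: inner_commute)
    then have "inner (blinfun_apply (s o\<^sub>L a) x) x = inner (blinfun_apply (s o\<^sub>L u) x) x"
      by (simp add: a_def op_simps)
    then show ?thesis using psdD(2)[OF s(4), of x] by simp
  qed
  have U: "s \<in> Units (op_monoid A)" "u \<in> Units (op_monoid A)"
    using s u Units_op_monoidI by auto
  have "connected_component (Units (op_monoid A)) s u"
  proof (rule connected_component_segment)
    fix t :: real assume t: "0 \<le> t" "t \<le> 1"
    show "(1 - t) *\<^sub>R s + t *\<^sub>R u \<in> Units (op_monoid A)"
    \<comment> \<open>Multiplied by \<open>s\<close>, the segment becomes
      \<open>(1 - t) + t s u\<close>, coercive with constant \<open>1 - t\<close>. This degenerates
      at \<open>t = 1\<close>, where the point is \<open>u\<close> itself.\<close>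
    proof (cases "t = 1")
      case False
      define w where "w = (1 - t) *\<^sub>R id_blinfun + t *\<^sub>R (s o\<^sub>L u)"
      have "w \<in> Units (op_monoid A)"
      proof (rule coercive_Units)
        show "w \<in> A" using s unfolding w_def by (intro algebra_in u) auto
        show "0 < 1 - t" using False t by simp
        show "(1 - t) * (norm x)\<^sup>2 \<le> inner (blinfun_apply w x) x" for x
          using re[of x] t by (simp add: w_def op_simps power2_norm_eq_inner)
      qed
      moreover have "(1 - t) *\<^sub>R s + t *\<^sub>R u = s o\<^sub>L w"
        by (rule blinfun_eqI) (simp add: w_def op_simps ss)
      ultimately show ?thesis using compose_Units[OF U(1)] by simp
    qed (use U in simp)
  qed
  then show thesis using that s by blast
qed

text \<open>The root \<open>h\<close> of \<open>k g\<close>, with \<open>k\<close> the adjoint of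
  \<open>g\<close>, is coercive because \<open>g\<close> is invertible. As \<open>g = u h\<close>,
  the segment from \<open>u\<close> to \<open>g\<close> is \<open>u\<close> times the segment from 1
  to \<open>h\<close>, along which coercivity persists.\<close>

lemma polar_connected:
  assumes g: "g \<in> Units (op_monoid A)"
  obtains u v where "u \<in> A" "v \<in> A" "u o\<^sub>L v = id_blinfun" "v o\<^sub>L u = id_blinfun"
    "\<And>x y. inner (blinfun_apply u x) y = inner x (blinfun_apply v y)"
    "connected_component (Units (op_monoid A)) u g"
proof -
  obtain g' where g': "g \<in> A" "g' \<in> A" "g o\<^sub>L g' = id_blinfun" "g' o\<^sub>L g = id_blinfun"
    using g by (auto simp: Units_op_monoid)
  obtain k where k: "k \<in> A" "\<And>x y. inner (blinfun_apply g x) y = inner x (blinfun_apply k y)"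
    using inner_adjoint[OF g'(1)] by metis
  have k': "inner (blinfun_apply k x) y = inner x (blinfun_apply g y)" for x y
    using k(2)[of y x] by (simp add: inner_commute)
  define b where "b = k o\<^sub>L g"
  have b: "b \<in> A" "sym_op b"
    unfolding b_def sym_op_def by (intro compose_in k g') (simp add: k(2) k')
  define K where "K = norm g' + 1"
  have K: "K > 0" unfolding K_def by (simp add: add_nonneg_pos)
  have "inverse (K\<^sup>2) * (norm x)\<^sup>2 \<le> inner (blinfun_apply b x) x" for x
  proof -
    have "norm x = norm (blinfun_apply g' (blinfun_apply g x))"
      using g'(4) by (metis blinfun_apply_blinfun_compose blinfun_apply_id_blinfun)
    also have "\<dots> \<le> norm g' * norm (blinfun_apply g x)" by (rule norm_blinfun)
    also have "\<dots> \<le> K * norm (blinfun_apply g x)"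
      unfolding K_def by (intro mult_right_mono) auto
    finally have "(norm x)\<^sup>2 \<le> K\<^sup>2 * (norm (blinfun_apply g x))\<^sup>2"
      using K by (metis norm_ge_zero power_mono power_mult_distrib)
    also have "(norm (blinfun_apply g x))\<^sup>2 = inner (blinfun_apply b x) x"
      by (simp add: b_def k' power2_norm_eq_inner)
    finally show ?thesis using K by (simp add: field_simps)
  qed
  then obtain h d where h: "h \<in> A" "psd h" "h o\<^sub>L h = b" "0 < d"
    and d: "\<And>x. d * (norm x)\<^sup>2 \<le> inner (blinfun_apply h x) x"
    using coercive_square_root[OF b, of "inverse (K\<^sup>2)"] K
    by (metis inverse_positive_iff_positive zero_less_power)
  obtain h' where h': "h o\<^sub>L h' = id_blinfun" "h' o\<^sub>L h = id_blinfun"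
    using coercive_invertible[OF h(4) d] by blast
  have h'A: "h' \<in> A" by (rule inverse_in[OF h(1) h'])
  have hh': "blinfun_apply h (blinfun_apply h' x) = x" "blinfun_apply h' (blinfun_apply h x) = x" for x
    using h' by (metis blinfun_apply_blinfun_compose blinfun_apply_id_blinfun)+
  have symh': "inner (blinfun_apply h' x) y = inner x (blinfun_apply h' y)" for x y
    using sym_opD[OF psdD(1)[OF h(2)], of "blinfun_apply h' x" "blinfun_apply h' y"]
    by (simp add: hh')
  define u where "u = g o\<^sub>L h'"
  define v where "v = h' o\<^sub>L k"
  have uv: "u \<in> A" "v \<in> A" unfolding u_def v_def by (intro compose_in g' h'A k)+
  have vu: "v o\<^sub>L u = id_blinfun"
  proof -
    have "v o\<^sub>L u = h' o\<^sub>L (b o\<^sub>L h')" by (simp add: u_def v_def b_def compose_assoc)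
    also have "\<dots> = id_blinfun" by (simp add: h'[folded] compose_assoc flip: h(3))
    finally show ?thesis .
  qed
  \<comment> \<open>\<open>v\<close> is a left inverse of \<open>u\<close> and \<open>h g'\<close> a
    right inverse, so they agree and the isometry \<open>u\<close> is unitary.\<close>
  have inv: "u o\<^sub>L (h o\<^sub>L g') = id_blinfun"
    unfolding u_def by (metis compose_assoc compose_id h'(2) g'(3))
  then have "v = h o\<^sub>L g'" by (metis vu compose_assoc compose_id)
  with inv have uv': "u o\<^sub>L v = id_blinfun" by simp
  have adj: "inner (blinfun_apply u x) y = inner x (blinfun_apply v y)" for x y
    by (simp add: u_def v_def k(2) symh')
  have U: "u \<in> Units (op_monoid A)" using Units_op_monoidI[OF uv(1) uv' vu] .
  have "connected_component (Units (op_monoid A)) u g"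
  proof (rule connected_component_segment)
    fix t :: real assume t: "0 \<le> t" "t \<le> 1"
    define w where "w = (1 - t) *\<^sub>R id_blinfun + t *\<^sub>R h"
    have "w \<in> Units (op_monoid A)"
    proof (rule coercive_Units)
      show "w \<in> A" unfolding w_def by (intro algebra_in h)
      show "0 < min 1 d" using h by simp
      fix x :: 'h
      have "min 1 d * (norm x)\<^sup>2 = (1 - t) * (min 1 d * (norm x)\<^sup>2) + t * (min 1 d * (norm x)\<^sup>2)"
        by (simp add: algebra_simps)
      also have "\<dots> \<le> (1 - t) * (1 * (norm x)\<^sup>2) + t * (d * (norm x)\<^sup>2)"
        using t by (intro add_mono mult_left_mono mult_right_mono) auto
      also have "\<dots> \<le> inner (blinfun_apply w x) x"
        using mult_left_mono[OF d[of x] t(1)] by (simp add: w_def op_simps power2_norm_eq_inner)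
      finally show "min 1 d * (norm x)\<^sup>2 \<le> inner (blinfun_apply w x) x" .
    qed
    moreover have "(1 - t) *\<^sub>R u + t *\<^sub>R g = u o\<^sub>L w"
      by (rule blinfun_eqI) (simp add: w_def u_def op_simps hh')
    ultimately show "(1 - t) *\<^sub>R u + t *\<^sub>R g \<in> Units (op_monoid A)"
      using compose_Units[OF U] by simp
  qed
  then show thesis by (intro that[OF uv uv' vu adj])
qed

theorem connected_Units: "connected (Units (op_monoid A))"
proof -
  have "connected_component (Units (op_monoid A)) g id_blinfun" if g: "g \<in> Units (op_monoid A)" for g
  proof -
    obtain u v where u: "u \<in> A" "v \<in> A" "u o\<^sub>L v = id_blinfun" "v o\<^sub>L u = id_blinfun"
      "\<And>x y. inner (blinfun_apply u x) y = inner x (blinfun_apply v y)"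
      "connected_component (Units (op_monoid A)) u g"
      using polar_connected[OF g] by metis
    obtain s where s: "s \<in> A" "s o\<^sub>L s = id_blinfun" "connected_component (Units (op_monoid A)) s u"
      using unitary_connected_to_symmetry[OF u(1-5)] by metis
    show ?thesis
      using symmetry_connected_to_id[OF s(1,2)] s(3) u(6)
      by (meson connected_component_sym connected_component_trans)
  qed
  then show ?thesis
    by (meson connected_component_sym connected_component_trans connected_iff_connected_component)
qed

end

section \<open>Von Neumann algebras and normal conditional expectations\<close>

lemma bounded_opsD: "a \<in> bounded_ops \<Longrightarrow> blinfun_apply a (c *\<^sub>C x) = c *\<^sub>C blinfun_apply a x"
  by (simp add: bounded_ops_def)

lemma bounded_linear_cscale: "bounded_linear (\<lambda>x :: 'h::chilbert_space. c *\<^sub>C x)"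
  by (rule bounded_linear_intro[where K = "cmod c"])
    (simp_all add: cscale_add_right cscale_scaleR norm_cscale mult.commute)

lemma bounded_ops_strong_limit:
  assumes "\<And>n. b n \<in> bounded_ops"
    and lim: "\<And>x. (\<lambda>n. blinfun_apply (b n) x) \<longlonglongrightarrow> blinfun_apply p x"
  shows "p \<in> bounded_ops"
proof -
  have "blinfun_apply p (c *\<^sub>C x) = c *\<^sub>C blinfun_apply p x" for c x
  proof (rule LIMSEQ_unique[OF lim])
    show "(\<lambda>n. blinfun_apply (b n) (c *\<^sub>C x)) \<longlonglongrightarrow> c *\<^sub>C blinfun_apply p x"
      using bounded_linear.tendsto[OF bounded_linear_cscale lim] bounded_opsD[OF assms(1)] by simp
  qed
  then show ?thesis by (simp add: bounded_ops_def)
qed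

lemma commutantI: "a \<in> bounded_ops \<Longrightarrow> (\<And>b. b \<in> S \<Longrightarrow> a o\<^sub>L b = b o\<^sub>L a) \<Longrightarrow> a \<in> commutant S"
  by (simp add: commutant_def)

lemma commutantD:
  assumes "a \<in> commutant S"
  shows "a \<in> bounded_ops" "b \<in> S \<Longrightarrow> a o\<^sub>L b = b o\<^sub>L a"
  using assms by (simp_all add: commutant_def)

lemma commutant_strong_limit:
  assumes b: "\<And>n. b n \<in> commutant S"
    and lim: "\<And>x. (\<lambda>n. blinfun_apply (b n) x) \<longlonglongrightarrow> blinfun_apply p x"
  shows "p \<in> commutant S"
proof (rule commutantI)
  show "p \<in> bounded_ops" using bounded_ops_strong_limit[OF commutantD(1)[OF b] lim] .
  show "p o\<^sub>L c = c o\<^sub>L p" if "c \<in> S" for c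
    using commute_strong_limit[OF lim commutantD(2)[OF b that]] .
qed

text \<open>Commutants are closed under strong limits of arbitrary sequences, which covers both norm
  limits and monotone limits.\<close>

lemma op_algebra_commutant: "op_algebra (commutant S)"
proof
  show "id_blinfun \<in> commutant S" by (simp add: commutant_def bounded_ops_def)
next
  fix a b assume ab: "a \<in> commutant S" "b \<in> commutant S"
  note [simp] = bounded_opsD[OF commutantD(1)[OF ab(1)]] bounded_opsD[OF commutantD(1)[OF ab(2)]]
  show "a + b \<in> commutant S"
  proof (rule commutantI)
    show "a + b \<in> bounded_ops" by (simp add: bounded_ops_def blinfun.add_left cscale_add_right)
    show "(a + b) o\<^sub>L c = c o\<^sub>L (a + b)" if "c \<in> S" for c
      unfolding compose_bilinear commutantD(2)[OF ab(1) that] commutantD(2)[OF ab(2) that] ..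
  qed
  show "a o\<^sub>L b \<in> commutant S"
  proof (rule commutantI)
    show "a o\<^sub>L b \<in> bounded_ops" by (simp add: bounded_ops_def)
    show "(a o\<^sub>L b) o\<^sub>L c = c o\<^sub>L (a o\<^sub>L b)" if "c \<in> S" for c
      using commutantD(2)[OF ab(1) that] commutantD(2)[OF ab(2) that] by (metis compose_assoc)
  qed
next
  fix a r assume a: "a \<in> commutant S"
  show "r *\<^sub>R a \<in> commutant S"
  proof (rule commutantI)
    show "r *\<^sub>R a \<in> bounded_ops"
      by (simp add: bounded_ops_def blinfun.scaleR_left cscale_scaleR bounded_opsD[OF commutantD(1)[OF a]])
    show "(r *\<^sub>R a) o\<^sub>L c = c o\<^sub>L (r *\<^sub>R a)" if "c \<in> S" for c
      unfolding compose_bilinear commutantD(2)[OF a that] ..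
  qed
next
  fix a b assume a: "a \<in> commutant S" and ab: "a o\<^sub>L b = id_blinfun" "b o\<^sub>L a = id_blinfun"
  show "b \<in> commutant S"
  proof (rule commutantI)
    have "blinfun_apply b (c *\<^sub>C x) = c *\<^sub>C blinfun_apply b x" for c x
      using bounded_opsD[OF commutantD(1)[OF a], of c "blinfun_apply b x"] ab
      by (metis blinfun_apply_blinfun_compose blinfun_apply_id_blinfun)
    then show "b \<in> bounded_ops" by (simp add: bounded_ops_def)
    show "b o\<^sub>L c = c o\<^sub>L b" if "c \<in> S" for c
      using compose_inverse_commute[OF ab commutantD(2)[OF a that]] .
  qed
next
  show "closed (commutant S)"
    unfolding closed_sequential_limits
    using commutant_strong_limit norm_tendsto_strong by blast
next
  fix s :: "nat \<Rightarrow> _" and p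
  assume "\<And>n. s n \<in> commutant S" "\<And>x. (\<lambda>n. blinfun_apply (s n) x) \<longlonglongrightarrow> blinfun_apply p x"
  then show "p \<in> commutant S" by (rule commutant_strong_limit)
qed

lemma cscale_op_compose_left: "cscale_op c a o\<^sub>L b = cscale_op c (a o\<^sub>L b)"
  by (rule blinfun_eqI) (simp add: cscale_op.rep_eq)

lemma cscale_op_compose_right: "a \<in> bounded_ops \<Longrightarrow> a o\<^sub>L cscale_op c b = cscale_op c (a o\<^sub>L b)"
  by (rule blinfun_eqI) (simp add: cscale_op.rep_eq bounded_opsD)

lemma cscale_op_commutant:
  assumes a: "a \<in> commutant S" and S: "S \<subseteq> bounded_ops"
  shows "cscale_op c a \<in> commutant S"
proof (rule commutantI)
  show "cscale_op c a \<in> bounded_ops"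
    by (simp add: bounded_ops_def cscale_op.rep_eq bounded_opsD[OF commutantD(1)[OF a]]
        cscale_cscale mult.commute)
  show "cscale_op c a o\<^sub>L b = b o\<^sub>L cscale_op c a" if "b \<in> S" for b
    using S that commutantD(2)[OF a that]
    by (simp add: cscale_op_compose_left cscale_op_compose_right subset_eq)
qed

lemma commutant_subset_bounded_ops: "commutant S \<subseteq> bounded_ops"
  by (auto simp: commutant_def)

text \<open>A von Neumann algebra is itself a commutant, that of \<open>commutant A\<close>, and
  inherits its closure properties from there.\<close>

lemma von_neumann_star_op_algebra:
  assumes "von_neumann_algebra A"
  shows "star_op_algebra A"
proof -
  have A: "commutant (commutant A) = A" "A \<subseteq> bounded_ops" "\<And>a. a \<in> A \<Longrightarrow> \<exists>b\<in>A. is_adjoint a b"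
    using assms by (auto simp: von_neumann_algebra_def)
  interpret op_algebra A using op_algebra_commutant[of "commutant A"] unfolding A(1) .
  show ?thesis
  proof
    show "cscale_op c a \<in> A" if "a \<in> A" for a c
      using cscale_op_commutant[of a "commutant A" c] that commutant_subset_bounded_ops
      unfolding A(1) by blast
  qed (use A in blast)+
qed

lemma norm_cscale_op_le: "norm (cscale_op c a) \<le> cmod c * norm a"
proof (rule norm_blinfun_bound)
  fix x
  show "norm (blinfun_apply (cscale_op c a) x) \<le> cmod c * norm a * norm x"
    using mult_left_mono[OF norm_blinfun[of a x], of "cmod c"]
    by (simp add: cscale_op.rep_eq norm_cscale mult.assoc)
qed simp

lemma adjoint_unique:
  fixes b c :: "'h::real_inner \<Rightarrow>\<^sub>L 'h"
  assumes "\<And>x y. inner (blinfun_apply a x) y = inner x (blinfun_apply b y)"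
    and "\<And>x y. inner (blinfun_apply a x) y = inner x (blinfun_apply c y)"
  shows "b = c"
proof (rule blinfun_eqI)
  fix y
  have "\<forall>x. inner x (blinfun_apply b y) = inner x (blinfun_apply c y)" using assms by metis
  then show "blinfun_apply b y = blinfun_apply c y" by (simp add: vector_eq_ldot)
qed

lemma norm_adjoint_le:
  fixes a b :: "'h::real_inner \<Rightarrow>\<^sub>L 'h"
  assumes "\<And>x y. inner (blinfun_apply a x) y = inner x (blinfun_apply b y)"
  shows "norm b \<le> norm a"
proof (rule norm_blinfun_bound)
  fix y
  let ?z = "blinfun_apply b y"
  have "norm ?z * norm ?z = inner (blinfun_apply a ?z) y"
    by (simp add: assms power2_norm_eq_inner flip: power2_eq_square)
  also have "\<dots> \<le> norm (blinfun_apply a ?z) * norm y" by (rule norm_cauchy_schwarz)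
  also have "\<dots> \<le> (norm a * norm ?z) * norm y" by (intro mult_right_mono norm_blinfun) simp
  finally have "norm ?z * norm ?z \<le> (norm a * norm y) * norm ?z" by (simp add: mult_ac)
  then show "norm ?z \<le> norm a * norm y"
    by (cases "?z = 0") (auto simp: mult_le_cancel_right)
qed simp

text \<open>Both \<open>D\<close> and \<open>\<i> D\<close> are tested because a skew operator has
  zero real form. Together they make the complex form vanish, so \<open>D\<close> is positive, hence
  symmetric, and the form bounds its norm by 0.\<close>

lemma bounded_ops_zero_numerical_range:
  assumes D: "D \<in> bounded_ops" and re: "\<And>x. inner (blinfun_apply D x) x = 0"
    and im: "\<And>x. inner (blinfun_apply (cscale_op \<i> D) x) x = 0"
  shows "D = 0"
proof -
  have "Im (cinner (blinfun_apply D x) x) = 0" for x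
    using im[of x] by (simp add: Im_cinner cscale_op.rep_eq inner_ii_left)
  then have "positive_op D"
    using re by (simp add: positive_op_def complex_nonneg_Reals_iff flip: inner_eq_Re_cinner)
  then have "sym_op D" using positive_op_iff_psd[OF D] psdD(1) by blast
  then have "norm D \<le> 0" using re by (intro sym_op_norm_le) auto
  then show ?thesis by simp
qed

text \<open>The Cartesian decomposition; the norm bounds hold because the adjoint has no larger norm
  than \<open>x\<close>.\<close>

lemma (in star_op_algebra) real_imaginary_parts:
  assumes x: "x \<in> A" "x' \<in> A" and adj: "\<And>y z. inner (blinfun_apply x y) z = inner y (blinfun_apply x' z)"
  obtains a c where "a \<in> A" "c \<in> A" "sym_op a" "sym_op c" "x = a + cscale_op \<i> c"
    "x' = a - cscale_op \<i> c" "norm a \<le> norm x" "norm c \<le> norm x"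
proof -
  have adj': "inner (blinfun_apply x' y) z = inner y (blinfun_apply x z)" for y z
    using adj[of z y] by (simp add: inner_commute)
  define a where "a = (1/2) *\<^sub>R (x + x')"
  define b where "b = (1/2) *\<^sub>R (x - x')"
  define c where "c = cscale_op (- \<i>) b"
  have A: "a \<in> A" "b \<in> A" "c \<in> A" unfolding a_def b_def c_def by (intro algebra_in cscale_in x)+
  have ic: "cscale_op \<i> c = b"
    using cscale_of_real[of 1] by (intro blinfun_eqI) (simp add: c_def cscale_op.rep_eq cscale_cscale)
  have x_eq: "x = a + b" "x' = a - b"
    by (simp_all add: a_def b_def flip: scaleR_add_right scaleR_diff_right)
  have skew: "inner (blinfun_apply b y) z = - inner y (blinfun_apply b z)" for y z
    by (simp add: b_def op_simps adj adj' algebra_simps)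
  have bb: "blinfun_apply b (k *\<^sub>C y) = k *\<^sub>C blinfun_apply b y" for k y
    using A complex_linear bounded_opsD by blast
  have neg: "(- \<i>) *\<^sub>C y = - (\<i> *\<^sub>C y)" for y :: 'h
    using cscale_of_real[of "-1" "\<i> *\<^sub>C y"] by (simp add: cscale_cscale)
  have symc: "sym_op c"
    unfolding sym_op_def c_def cscale_op.rep_eq neg
    by (simp add: inner_ii_left skew bb)
  have syma: "sym_op a"
    by (simp add: sym_op_def a_def op_simps adj adj' algebra_simps)
  have n: "norm x' \<le> norm x" using norm_adjoint_le[OF adj] .
  have "norm a \<le> norm x" using norm_triangle_ineq[of x x'] n by (simp add: a_def)
  moreover have "norm b \<le> norm x" using norm_triangle_ineq4[of x x'] n by (simp add: b_def)
  then have "norm c \<le> norm x" using norm_cscale_op_le[of "- \<i>" b] by (simp add: c_def)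
  ultimately show thesis using that[OF A(1,3) syma symc] x_eq unfolding ic by blast
qed

lemma inv_inv_group:
  assumes "g \<in> M" "h \<in> M" "g o\<^sub>L h = id_blinfun" "h o\<^sub>L g = id_blinfun"
  shows "inv\<^bsub>inv_group M\<^esub> g = h"
proof -
  have "(THE y. y \<in> Units (op_monoid M) \<and> g o\<^sub>L y = id_blinfun \<and> y o\<^sub>L g = id_blinfun) = h"
  proof (rule the_equality)
    show "h \<in> Units (op_monoid M) \<and> g o\<^sub>L h = id_blinfun \<and> h o\<^sub>L g = id_blinfun"
      using assms by (auto simp: Units_op_monoid)
    show "y = h" if "y \<in> Units (op_monoid M) \<and> g o\<^sub>L y = id_blinfun \<and> y o\<^sub>L g = id_blinfun" for y
      using that assms by (metis compose_assoc compose_id)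
  qed
  then show ?thesis
    by (simp add: m_inv_def units_of_def op_monoid_def)
qed

section \<open>Continuity, adjoints and normality of the expectation\<close>

locale normal_expectation =
  fixes M N :: "('h::chilbert_space \<Rightarrow>\<^sub>L 'h) set" and E :: "('h \<Rightarrow>\<^sub>L 'h) \<Rightarrow> ('h \<Rightarrow>\<^sub>L 'h)"
  assumes vM: "von_neumann_algebra M"
    and cond: "conditional_expectation M N E"
    and normal: "normal_map M N E"
begin

lemma vN: "von_neumann_algebra N"
  using cond by (simp add: conditional_expectation_def)

sublocale M: star_op_algebra M by (rule von_neumann_star_op_algebra[OF vM])

sublocale N: star_op_algebra N by (rule von_neumann_star_op_algebra[OF vN])

lemma N_sub: "n \<in> N \<Longrightarrow> n \<in> M" and E_in: "x \<in> M \<Longrightarrow> E x \<in> N"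
  and E_add: "x \<in> M \<Longrightarrow> y \<in> M \<Longrightarrow> E (x + y) = E x + E y"
  and E_cscale: "x \<in> M \<Longrightarrow> E (cscale_op c x) = cscale_op c (E x)"
  and E_fix: "n \<in> N \<Longrightarrow> E n = n"
  and E_mod: "a \<in> N \<Longrightarrow> b \<in> N \<Longrightarrow> x \<in> M \<Longrightarrow> E (a o\<^sub>L x o\<^sub>L b) = a o\<^sub>L E x o\<^sub>L b"
  using cond unfolding conditional_expectation_def by blast+

lemma E_left: "a \<in> N \<Longrightarrow> x \<in> M \<Longrightarrow> E (a o\<^sub>L x) = a o\<^sub>L E x"
  using E_mod[OF _ N.id_in] by simp

lemma E_right: "a \<in> N \<Longrightarrow> x \<in> M \<Longrightarrow> E (x o\<^sub>L a) = E x o\<^sub>L a"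
  using E_mod[OF N.id_in] by simp

lemma E_scaleR: "x \<in> M \<Longrightarrow> E (r *\<^sub>R x) = r *\<^sub>R E x"
proof -
  have "r *\<^sub>R a = cscale_op (of_real r) a" for a :: "'h \<Rightarrow>\<^sub>L 'h"
    by (rule blinfun_eqI) (simp add: cscale_op.rep_eq cscale_of_real blinfun.scaleR_left)
  then show "x \<in> M \<Longrightarrow> E (r *\<^sub>R x) = r *\<^sub>R E x" by (simp add: E_cscale)
qed

lemma E_diff: "x \<in> M \<Longrightarrow> y \<in> M \<Longrightarrow> E (x - y) = E x - E y"
  using E_add[of x "(-1) *\<^sub>R y"] M.scaleR_in[of y "-1"] E_scaleR[of y "-1"] by simp

lemma M_bounded_ops: "x \<in> M \<Longrightarrow> x \<in> bounded_ops"
  using M.complex_linear by blast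

lemma E_bounded_ops: "x \<in> M \<Longrightarrow> E x \<in> bounded_ops"
  using E_in N_sub M_bounded_ops by blast

lemma E_psd: "x \<in> M \<Longrightarrow> psd x \<Longrightarrow> psd (E x)"
  using cond positive_op_iff_psd[OF M_bounded_ops[of x]] positive_op_iff_psd[OF E_bounded_ops[of x]]
  unfolding conditional_expectation_def by blast

lemma E_id: "E id_blinfun = id_blinfun"
  by (rule E_fix[OF N.id_in])

text \<open>Positivity of \<open>E\<close> is applied to \<open>norm x + x\<close>. The result gives
  symmetry of \<open>E x\<close> after subtracting the scalar, and the norm bound when used for both
  \<open>x\<close> and \<open>-x\<close>.\<close>

lemma psd_norm_id_add_E:
  assumes "x \<in> M" "sym_op x"
  shows "psd (norm x *\<^sub>R id_blinfun + E x)"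
proof -
  have "- inner (blinfun_apply x y) y \<le> norm x * (norm y)\<^sup>2" for y
  proof -
    have "- inner (blinfun_apply x y) y \<le> norm (blinfun_apply x y) * norm y"
      using Cauchy_Schwarz_ineq2[of "blinfun_apply x y" y] by linarith
    also have "\<dots> \<le> norm x * norm y * norm y" by (intro mult_right_mono norm_blinfun) simp
    finally show ?thesis by (simp add: power2_eq_square mult.assoc)
  qed
  then have "0 \<le> inner (blinfun_apply (norm x *\<^sub>R id_blinfun + x) y) y" for y
    by (simp add: op_simps power2_norm_eq_inner[symmetric]) (smt (verit))
  then have "psd (norm x *\<^sub>R id_blinfun + x)"
    by (simp add: psd_def sym_op_add sym_op_scaleR sym_op_id assms)
  then have "psd (E (norm x *\<^sub>R id_blinfun + x))"
    by (intro E_psd M.algebra_in assms)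
  then show ?thesis
    by (simp add: E_add E_scaleR E_id M.algebra_in assms)
qed

lemma E_sym:
  assumes "x \<in> M" "sym_op x"
  shows "sym_op (E x)"
  using sym_op_diff[OF psdD(1)[OF psd_norm_id_add_E[OF assms]] sym_op_scaleR[OF sym_op_id, of "norm x"]]
  by simp

lemma E_norm_sym:
  assumes x: "x \<in> M" "sym_op x"
  shows "norm (E x) \<le> norm x"
proof (rule sym_op_norm_le[OF E_sym[OF x]])
  fix y
  have x': "(-1) *\<^sub>R x \<in> M" "sym_op ((-1) *\<^sub>R x)"
    by (intro M.algebra_in sym_op_scaleR x)+
  show "\<bar>inner (blinfun_apply (E x) y) y\<bar> \<le> norm x * (norm y)\<^sup>2"
    using psdD(2)[OF psd_norm_id_add_E[OF x], of y] psdD(2)[OF psd_norm_id_add_E[OF x'], of y]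
    unfolding E_scaleR[OF x(1)] by (simp add: op_simps power2_norm_eq_inner)
qed simp

text \<open>The factor 2 comes from estimating the two Cartesian parts separately; any constant
  would serve norm continuity and the choice of a neighbourhood.\<close>

lemma E_bounded:
  assumes x: "x \<in> M"
  shows "norm (E x) \<le> 2 * norm x"
proof -
  obtain x' where x': "x' \<in> M" "\<And>y z. inner (blinfun_apply x y) z = inner y (blinfun_apply x' z)"
    using M.inner_adjoint[OF x] by metis
  obtain a c where ac: "a \<in> M" "c \<in> M" "sym_op a" "sym_op c" "x = a + cscale_op \<i> c"
    "norm a \<le> norm x" "norm c \<le> norm x"
    using M.real_imaginary_parts[OF x x'] by metis
  have "E x = E a + cscale_op \<i> (E c)"
    unfolding ac(5) by (simp add: E_add E_cscale M.cscale_in ac)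
  then have "norm (E x) \<le> norm (E a) + norm (E c)"
    using norm_triangle_ineq[of "E a" "cscale_op \<i> (E c)"] norm_cscale_op_le[of \<i> "E c"] by simp
  then show ?thesis
    using E_norm_sym[OF ac(1,3)] E_norm_sym[OF ac(2,4)] ac(6,7) by linarith
qed

lemma E_adjoint:
  assumes x: "x \<in> M" "x' \<in> M" and adj: "\<And>y z. inner (blinfun_apply x y) z = inner y (blinfun_apply x' z)"
  shows "inner (blinfun_apply (E x) y) z = inner y (blinfun_apply (E x') z)"
proof -
  obtain a c where ac: "a \<in> M" "c \<in> M" "sym_op a" "sym_op c" "x = a + cscale_op \<i> c"
    "x' = a - cscale_op \<i> c"
    using M.real_imaginary_parts[OF x adj] by metis
  have "E x = E a + cscale_op \<i> (E c)" "E x' = E a - cscale_op \<i> (E c)"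
    unfolding ac(5,6) by (simp_all add: E_add E_diff E_cscale M.cscale_in ac)
  then show ?thesis
    using sym_opD[OF E_sym[OF ac(1,3)]] sym_opD[OF E_sym[OF ac(2,4)]]
    by (simp add: op_simps cscale_op.rep_eq inner_ii_left bounded_opsD[OF E_bounded_ops[OF ac(2)]])
qed

lemma E_tendsto:
  assumes "\<And>n. y n \<in> M" "l \<in> M" "y \<longlonglongrightarrow> l"
  shows "(\<lambda>n. E (y n)) \<longlonglongrightarrow> E l"
proof (rule LIM_zero_cancel, rule Lim_null_comparison)
  show "\<forall>\<^sub>F n in sequentially. norm (E (y n) - E l) \<le> 2 * norm (y n - l)"
    using E_bounded[OF M.diff_in[OF assms(1,2)]] by (simp add: E_diff assms)
  show "(\<lambda>n. 2 * norm (y n - l)) \<longlonglongrightarrow> 0"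
    using tendsto_mult_left[OF tendsto_norm_zero[OF LIM_zero[OF assms(3)]], of 2] by simp
qed

text \<open>The range of the sequence is directed and its strong limit \<open>p\<close> is its
  supremum, so normality makes \<open>E p\<close> the least upper bound of the
  \<open>E (b n)\<close> in \<open>N\<close>. Their strong limit \<open>r\<close> is another upper
  bound, hence \<open>E p \<le> r\<close>, and the form of \<open>E (p - b n)\<close> is squeezed
  between 0 and that of \<open>r - E (b n)\<close>.\<close>

lemma E_monotone_limit:
  assumes b: "\<And>n. b n \<in> M" and pos: "\<And>n. psd (b n)" and le: "\<And>n. psd (id_blinfun - b n)"
    and mono: "\<And>n. psd (b (Suc n) - b n)"
    and lim: "\<And>x. (\<lambda>n. blinfun_apply (b n) x) \<longlonglongrightarrow> blinfun_apply p x"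
  shows "(\<lambda>n. inner (blinfun_apply (E (p - b n)) x) x) \<longlonglongrightarrow> 0"
proof -
  have pM: "p \<in> M" by (rule M.monotone_limit_in[where s = b, OF b pos le mono lim])
  have psdp: "psd p" by (rule psd_tendsto[where b = b, OF pos lim])
  have diff: "psd (b m - b n)" if "n \<le> m" for n m
    by (rule psd_increasing[where b = b, OF mono that])
  have op_le_iff: "op_le a c \<longleftrightarrow> psd (c - a)" if "a \<in> M" "c \<in> M" for a c
    unfolding op_le_def using that by (intro positive_op_iff_psd M_bounded_ops M.diff_in)
  have sa_M: "selfadjoint_part M = {a \<in> M. sym_op a}"
    using is_adjoint_self_iff[OF M_bounded_ops] by (auto simp: selfadjoint_part_def)
  have sa_N: "selfadjoint_part N = {a \<in> N. sym_op a}"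
    using is_adjoint_self_iff[OF M_bounded_ops[OF N_sub]] by (auto simp: selfadjoint_part_def)
  have "is_op_sup M (range b) p"
    unfolding is_op_sup_def sa_M
  proof (intro conjI ballI impI)
    show "p \<in> {a \<in> M. sym_op a}" using pM psdp psdD(1) by blast
    show "op_le d p" if "d \<in> range b" for d
      using that psd_limit_diff[where b = b, OF mono lim] by (auto simp: op_le_iff b pM)
    show "op_le p t" if t: "t \<in> {a \<in> M. sym_op a}" "\<forall>d\<in>range b. op_le d t" for t
    proof -
      have "psd (t - b n)" for n using t op_le_iff[OF b, of t n] by auto
      moreover have "(\<lambda>n. blinfun_apply (t - b n) x) \<longlonglongrightarrow> blinfun_apply (t - p) x" for x
        unfolding blinfun.diff_left by (intro tendsto_diff tendsto_const lim)
      ultimately have "psd (t - p)" by (rule psd_tendsto[where b = "\<lambda>n. t - b n"])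
      then show ?thesis using op_le_iff[OF pM] t by auto
    qed
  qed
  moreover have "\<exists>c\<in>range b. op_le a c \<and> op_le a' c" if aa': "a \<in> range b" "a' \<in> range b" for a a'
  proof -
    obtain i j where ij: "a = b i" "a' = b j" using aa' by blast
    have "op_le (b i) (b (max i j))" "op_le (b j) (b (max i j))"
      by (simp_all add: op_le_iff b diff)
    then show ?thesis unfolding ij by blast
  qed
  moreover have "range b \<subseteq> selfadjoint_part M"
    unfolding sa_M using b pos psdD(1) by auto
  ultimately have sup: "is_op_sup N (E ` range b) (E p)"
    using normal[unfolded normal_map_def, THEN spec, of "range b", THEN spec, of p] by simp
  have Epos: "psd (E (b n))" for n by (intro E_psd b pos)
  have Ele: "psd (id_blinfun - E (b n))" for n
    using E_psd[OF M.diff_in[OF M.id_in b] le, of n] by (simp add: E_diff E_id b M.id_in)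
  have Emono: "psd (E (b (Suc n)) - E (b n))" for n
    using E_psd[OF M.diff_in[OF b b] mono[of n]] by (simp add: E_diff b)
  from monotone_psd_limit[where b = "\<lambda>n. E (b n)", OF Epos Ele Emono] obtain r
    where r: "\<And>x. (\<lambda>n. blinfun_apply (E (b n)) x) \<longlonglongrightarrow> blinfun_apply r x" by blast
  have rN: "r \<in> N"
    by (rule N.monotone_limit_in[where s = "\<lambda>n. E (b n)", OF E_in[OF b] Epos Ele Emono r])
  have psdr: "psd r" by (rule psd_tendsto[where b = "\<lambda>n. E (b n)", OF Epos r])
  have "\<forall>d\<in>E ` range b. op_le d r"
    using psd_limit_diff[where b = "\<lambda>n. E (b n)", OF Emono r] by (auto simp: op_le_iff E_in b rN N_sub)
  then have "op_le (E p) r"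
    using sup rN psdD(1)[OF psdr] unfolding is_op_sup_def sa_N by auto
  then have Epr: "psd (r - E p)" by (simp add: op_le_iff E_in pM rN N_sub)
  have upper: "inner (blinfun_apply (E (p - b n)) x) x \<le> inner (blinfun_apply (r - E (b n)) x) x" for n
    using psdD(2)[OF Epr, of x] by (simp add: E_diff pM b op_simps)
  have lower: "0 \<le> inner (blinfun_apply (E (p - b n)) x) x" for n
    using E_psd[OF M.diff_in[OF pM b] psd_limit_diff[where b = b, OF mono lim], of n] psdD(2) by blast
  have "(\<lambda>n. inner (blinfun_apply (r - E (b n)) x) x) \<longlonglongrightarrow> inner (blinfun_apply r x - blinfun_apply r x) x"
    unfolding blinfun.diff_left by (intro tendsto_inner tendsto_diff tendsto_const r)
  then have "(\<lambda>n. inner (blinfun_apply (r - E (b n)) x) x) \<longlonglongrightarrow> 0" by simp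
  show ?thesis
  proof (rule tendsto_sandwich)
    show "\<forall>\<^sub>F n in sequentially. 0 \<le> inner (blinfun_apply (E (p - b n)) x) x"
      using lower by simp
    show "\<forall>\<^sub>F n in sequentially.
        inner (blinfun_apply (E (p - b n)) x) x \<le> inner (blinfun_apply (r - E (b n)) x) x"
      using upper by simp
  qed (fact tendsto_const, fact)
qed

text \<open>Cauchy-Schwarz at the vector \<open>x\<close> for the form given by \<open>E\<close> of
  an adjoint times an operator, applied to \<open>d\<close> and \<open>m\<close>. As 0 <= d <= 1,
  the square of \<open>d\<close> may be replaced by \<open>d\<close>, whose form under
  \<open>E\<close> is what normality controls.\<close>

lemma E_Cauchy_Schwarz:
  assumes d: "d \<in> M" "psd d" "\<And>x. inner (blinfun_apply d x) x \<le> (norm x)\<^sup>2"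
    and m: "m \<in> M" "m' \<in> M" "\<And>x y. inner (blinfun_apply m x) y = inner x (blinfun_apply m' y)"
  shows "(inner (blinfun_apply (E (d o\<^sub>L m)) x) x)\<^sup>2
    \<le> inner (blinfun_apply (E (m' o\<^sub>L m)) x) x * inner (blinfun_apply (E d) x) x"
proof -
  have m'_adj: "inner (blinfun_apply m' x) y = inner x (blinfun_apply m y)" for x y
    using m(3)[of y x] by (simp add: inner_commute)
  note symd = sym_opD[OF psdD(1)[OF d(2)]]
  have mem: "m' o\<^sub>L m \<in> M" "m' o\<^sub>L d \<in> M" "d o\<^sub>L m \<in> M" "d o\<^sub>L d \<in> M"
    by (intro M.compose_in d m)+
  have "psd (d - (d o\<^sub>L d))"
    unfolding psd_def
  proof (intro conjI allI)
    show "sym_op (d - (d o\<^sub>L d))" by (intro sym_op_diff sym_op_square psdD(1) d)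
    show "0 \<le> inner (blinfun_apply (d - (d o\<^sub>L d)) x) x" for x
      using psd_le_id_norm[OF d(2,3), of x] by (simp add: op_simps symd power2_norm_eq_inner)
  qed
  then have "psd (E (d - (d o\<^sub>L d)))" by (intro E_psd M.algebra_in d)
  then have dd: "inner (blinfun_apply (E (d o\<^sub>L d)) x) x \<le> inner (blinfun_apply (E d) x) x"
    using psdD(2)[of "E (d - (d o\<^sub>L d))" x] by (simp add: E_diff d mem op_simps)
  have "inner (blinfun_apply (E (m' o\<^sub>L d)) x) x = inner x (blinfun_apply (E (d o\<^sub>L m)) x)"
    by (rule E_adjoint[OF mem(2,3)]) (simp add: symd m'_adj)
  then have md: "inner (blinfun_apply (E (m' o\<^sub>L d)) x) x = inner (blinfun_apply (E (d o\<^sub>L m)) x) x"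
    by (simp add: inner_commute)
  have mm: "psd (m' o\<^sub>L m)"
    unfolding psd_def
  proof (intro conjI allI)
    show "sym_op (m' o\<^sub>L m)" by (simp add: sym_op_def m'_adj m(3))
    show "0 \<le> inner (blinfun_apply (m' o\<^sub>L m) x) x" for x by (simp add: m'_adj)
  qed
  have "(inner (blinfun_apply (E (d o\<^sub>L m)) x) x)\<^sup>2
    \<le> inner (blinfun_apply (E (m' o\<^sub>L m)) x) x * inner (blinfun_apply (E (d o\<^sub>L d)) x) x"
  proof (rule quadratic_nonneg_discriminant)
    fix t :: real
    \<comment> \<open>\<open>w\<close> is the adjoint of \<open>m + t d\<close> times
      \<open>m + t d\<close>, multiplied out so that \<open>E\<close> acts termwise.\<close>
    define w where "w = (m' o\<^sub>L m) + (t *\<^sub>R ((m' o\<^sub>L d) + (d o\<^sub>L m)) + t\<^sup>2 *\<^sub>R (d o\<^sub>L d))"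
    have w: "blinfun_apply w y = blinfun_apply (m' + t *\<^sub>R d) (blinfun_apply (m + t *\<^sub>R d) y)" for y
      by (simp add: w_def op_simps power2_eq_square algebra_simps)
    let ?u = "blinfun_apply (m + t *\<^sub>R d)"
    have w_inner: "inner (blinfun_apply w y) z = inner (?u y) (?u z)" for y z
      unfolding w by (simp add: op_simps m'_adj symd algebra_simps)
    have "psd w"
      unfolding psd_def sym_op_def
      by (metis inner_commute inner_ge_zero w_inner)
    moreover have "w \<in> M" unfolding w_def by (intro M.algebra_in mem)
    ultimately have "0 \<le> inner (blinfun_apply (E w) x) x" using E_psd psdD(2) by blast
    also have "E w = E (m' o\<^sub>L m) + (t *\<^sub>R (E (m' o\<^sub>L d) + E (d o\<^sub>L m)) + t\<^sup>2 *\<^sub>R E (d o\<^sub>L d))"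
      unfolding w_def by (simp add: E_add E_scaleR mem M.add_in M.scaleR_in)
    finally show "0 \<le> inner (blinfun_apply (E (m' o\<^sub>L m)) x) x
        + 2 * t * inner (blinfun_apply (E (d o\<^sub>L m)) x) x
        + t\<^sup>2 * inner (blinfun_apply (E (d o\<^sub>L d)) x) x"
      by (simp add: op_simps md algebra_simps)
  qed
  also have "\<dots> \<le> inner (blinfun_apply (E (m' o\<^sub>L m)) x) x * inner (blinfun_apply (E d) x) x"
    using dd psdD(2)[OF E_psd[OF mem(1) mm], of x] by (intro mult_left_mono)
  finally show ?thesis .
qed

subsection \<open>The centralizer\<close>

abbreviation C where "C \<equiv> centralizer M N E"

lemma centralizerI:
  assumes "x \<in> M" "\<And>n. n \<in> N \<Longrightarrow> x o\<^sub>L n = n o\<^sub>L x" "\<And>m. m \<in> M \<Longrightarrow> E (x o\<^sub>L m) = E (m o\<^sub>L x)"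
  shows "x \<in> C"
  using assms M_bounded_ops by (simp add: centralizer_def commutant_def)

lemma centralizerD:
  assumes "x \<in> C"
  shows "x \<in> M" "x \<in> commutant N" "n \<in> N \<Longrightarrow> x o\<^sub>L n = n o\<^sub>L x" "m \<in> M \<Longrightarrow> E (x o\<^sub>L m) = E (m o\<^sub>L x)"
  using assms by (auto simp: centralizer_def commutant_def)

lemma centralizerI':
  "x \<in> M \<Longrightarrow> x \<in> commutant N \<Longrightarrow> (\<And>m. m \<in> M \<Longrightarrow> E (x o\<^sub>L m) = E (m o\<^sub>L x)) \<Longrightarrow> x \<in> C"
  by (simp add: centralizer_def)

sublocale commutant_N: op_algebra "commutant N" by (rule op_algebra_commutant)

text \<open>The centralizer identity for \<open>b n\<close> cancels, leaving
  \<open>E (p m) - E (m p) = E (d m) - E (m d)\<close> with \<open>d = p - b n\<close>. The left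
  side does not depend on \<open>n\<close>, while the form of the right side tends to 0 by normality
  and Cauchy-Schwarz.\<close>

lemma centralizer_monotone_limit:
  assumes b: "\<And>n. b n \<in> C" and pos: "\<And>n. psd (b n)" and le: "\<And>n. psd (id_blinfun - b n)"
    and mono: "\<And>n. psd (b (Suc n) - b n)"
    and lim: "\<And>x. (\<lambda>n. blinfun_apply (b n) x) \<longlonglongrightarrow> blinfun_apply p x"
  shows "p \<in> C"
proof -
  note bM = centralizerD(1)[OF b]
  have pM: "p \<in> M" by (rule M.monotone_limit_in[where s = b, OF bM pos le mono lim])
  define d where "d n = p - b n" for n
  have dM: "d n \<in> M" for n unfolding d_def by (intro M.diff_in pM bM)
  have psdd: "psd (d n)" for n
    unfolding d_def by (rule psd_limit_diff[where b = b, OF mono lim])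
  have "psd (id_blinfun - p)"
  proof (rule psd_tendsto[where b = "\<lambda>n. id_blinfun - b n", OF le])
    show "(\<lambda>n. blinfun_apply (id_blinfun - b n) x) \<longlonglongrightarrow> blinfun_apply (id_blinfun - p) x" for x
      unfolding blinfun.diff_left by (intro tendsto_diff tendsto_const lim)
  qed
  then have dle: "inner (blinfun_apply (d n) x) x \<le> (norm x)\<^sup>2" for n x
    using psdD(2)[of "id_blinfun - p" x] psdD(2)[OF pos, of n x]
    by (simp add: d_def op_simps power2_norm_eq_inner)
  have Ed: "(\<lambda>n. inner (blinfun_apply (E (d n)) x) x) \<longlonglongrightarrow> 0" for x
    unfolding d_def by (rule E_monotone_limit[where b = b, OF bM pos le mono lim])
  have left: "(\<lambda>n. inner (blinfun_apply (E (d n o\<^sub>L m)) x) x) \<longlonglongrightarrow> 0"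
    if m: "m \<in> M" "m' \<in> M" "\<And>x y. inner (blinfun_apply m x) y = inner x (blinfun_apply m' y)" for m m' x
  proof -
    have "(\<lambda>n. inner (blinfun_apply (E (m' o\<^sub>L m)) x) x * inner (blinfun_apply (E (d n)) x) x) \<longlonglongrightarrow> 0"
      using tendsto_mult_left[OF Ed, of "inner (blinfun_apply (E (m' o\<^sub>L m)) x) x" x] by simp
    then have "(\<lambda>n. (inner (blinfun_apply (E (d n o\<^sub>L m)) x) x)\<^sup>2) \<longlonglongrightarrow> 0"
      by (rule Lim_null_comparison[rotated]) (use E_Cauchy_Schwarz[OF dM psdd dle m] in simp)
    then show ?thesis by (simp add: power_tendsto_0_iff)
  qed
  have diag: "inner (blinfun_apply (E (p o\<^sub>L m) - E (m o\<^sub>L p)) x) x = 0" if m: "m \<in> M" for m x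
  proof -
    obtain m' where m': "m' \<in> M" "\<And>x y. inner (blinfun_apply m x) y = inner x (blinfun_apply m' y)"
      using M.inner_adjoint[OF m] by metis
    have m'_adj: "inner (blinfun_apply m' x) y = inner x (blinfun_apply m y)" for x y
      using m'(2)[of y x] by (simp add: inner_commute)
    \<comment> \<open>The adjoint of \<open>m d\<close> is \<open>d m'\<close>, so the estimate
      \<open>left\<close> also covers products with \<open>d\<close> on the right.\<close>
    have right: "inner (blinfun_apply (E (m o\<^sub>L d n)) x) x = inner (blinfun_apply (E (d n o\<^sub>L m')) x) x" for n
    proof -
      have "inner (blinfun_apply (E (m o\<^sub>L d n)) x) x = inner x (blinfun_apply (E (d n o\<^sub>L m')) x)"
        using sym_opD[OF psdD(1)[OF psdd]] dM m m'
        by (intro E_adjoint M.compose_in) simp_all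
      then show ?thesis by (simp add: inner_commute)
    qed
    have "inner (blinfun_apply (E (p o\<^sub>L m) - E (m o\<^sub>L p)) x) x
      = inner (blinfun_apply (E (d n o\<^sub>L m)) x) x - inner (blinfun_apply (E (m o\<^sub>L d n)) x) x" for n
    proof -
      have "p o\<^sub>L m = (d n o\<^sub>L m) + (b n o\<^sub>L m)" "m o\<^sub>L p = (m o\<^sub>L d n) + (m o\<^sub>L b n)"
        by (simp_all add: d_def compose_bilinear)
      then have "E (p o\<^sub>L m) - E (m o\<^sub>L p) = E (d n o\<^sub>L m) - E (m o\<^sub>L d n)"
        using centralizerD(4)[OF b m] dM bM m by (simp add: E_add M.compose_in)
      then show ?thesis by (simp add: op_simps)
    qed
    moreover have "(\<lambda>n. inner (blinfun_apply (E (d n o\<^sub>L m)) x) x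
        - inner (blinfun_apply (E (m o\<^sub>L d n)) x) x) \<longlonglongrightarrow> 0 - 0"
      unfolding right using m m' m'_adj by (intro tendsto_diff left) auto
    ultimately have "(\<lambda>n. inner (blinfun_apply (E (p o\<^sub>L m) - E (m o\<^sub>L p)) x) x) \<longlonglongrightarrow> 0"
      by simp
    then show ?thesis by (simp add: LIMSEQ_const_iff)
  qed
  show ?thesis
  proof (rule centralizerI'[OF pM])
    show "p \<in> commutant N" using commutant_strong_limit[where b = b, OF centralizerD(2)[OF b] lim] .
    fix m assume m: "m \<in> M"
    have cm: "cscale_op \<i> m \<in> M" by (rule M.cscale_in[OF m])
    \<comment> \<open>\<open>diag\<close> controls only the real part of the complex form; applied
      to \<open>\<i> m\<close> it controls the imaginary part as well.\<close>
    have *: "cscale_op \<i> (E (p o\<^sub>L m) - E (m o\<^sub>L p)) = E (p o\<^sub>L cscale_op \<i> m) - E (cscale_op \<i> m o\<^sub>L p)"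
    proof -
      have "cscale_op \<i> (E (p o\<^sub>L m) - E (m o\<^sub>L p)) = cscale_op \<i> (E ((p o\<^sub>L m) - (m o\<^sub>L p)))"
        using pM m by (simp add: E_diff M.compose_in)
      also have "\<dots> = E (cscale_op \<i> ((p o\<^sub>L m) - (m o\<^sub>L p)))"
        using pM m by (intro E_cscale[symmetric] M.diff_in M.compose_in)
      also have "cscale_op \<i> ((p o\<^sub>L m) - (m o\<^sub>L p)) = (p o\<^sub>L cscale_op \<i> m) - (cscale_op \<i> m o\<^sub>L p)"
      proof (rule blinfun_eqI)
        fix x
        have "\<i> *\<^sub>C (y - z) = \<i> *\<^sub>C y - \<i> *\<^sub>C z" for y z :: 'h
          using cscale_add_right[of \<i> "y - z" z] by (simp add: algebra_simps)
        then show "blinfun_apply (cscale_op \<i> ((p o\<^sub>L m) - (m o\<^sub>L p))) x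
          = blinfun_apply ((p o\<^sub>L cscale_op \<i> m) - (cscale_op \<i> m o\<^sub>L p)) x"
          by (simp add: cscale_op.rep_eq op_simps bounded_opsD[OF M_bounded_ops[OF pM]])
      qed
      finally show ?thesis using pM cm by (simp add: E_diff M.compose_in)
    qed
    have "E (p o\<^sub>L m) - E (m o\<^sub>L p) = 0"
    proof (rule bounded_ops_zero_numerical_range)
      have "E (p o\<^sub>L m) - E (m o\<^sub>L p) \<in> N" using pM m by (intro N.diff_in E_in M.compose_in)
      then show "E (p o\<^sub>L m) - E (m o\<^sub>L p) \<in> bounded_ops" using N.complex_linear by blast
    qed (use diag[OF m] diag[OF cm] * in auto)
    then show "E (p o\<^sub>L m) = E (m o\<^sub>L p)" by simp
  qed
qed

sublocale C: star_op_algebra C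
proof
  show "id_blinfun \<in> C"
    using M.id_in commutant_N.id_in by (intro centralizerI') auto
next
  fix a b assume ab: "a \<in> C" "b \<in> C"
  note aM = centralizerD(1)[OF ab(1)] and bM = centralizerD(1)[OF ab(2)]
    and aN = centralizerD(2)[OF ab(1)] and bN = centralizerD(2)[OF ab(2)]
  show "a + b \<in> C"
  proof (rule centralizerI'[OF M.add_in[OF aM bM] commutant_N.add_in[OF aN bN]])
    fix m assume m: "m \<in> M"
    show "E ((a + b) o\<^sub>L m) = E (m o\<^sub>L (a + b))"
      unfolding compose_bilinear
      using centralizerD(4)[OF ab(1) m] centralizerD(4)[OF ab(2) m] aM bM m
      by (simp add: E_add M.compose_in)
  qed
  show "a o\<^sub>L b \<in> C"
  proof (rule centralizerI'[OF M.compose_in[OF aM bM] commutant_N.compose_in[OF aN bN]])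
    fix m assume m: "m \<in> M"
    have "E (a o\<^sub>L (b o\<^sub>L m)) = E ((b o\<^sub>L m) o\<^sub>L a)" by (rule centralizerD(4)[OF ab(1) M.compose_in[OF bM m]])
    also have "\<dots> = E (b o\<^sub>L (m o\<^sub>L a))" by (simp only: compose_assoc)
    also have "\<dots> = E ((m o\<^sub>L a) o\<^sub>L b)" by (rule centralizerD(4)[OF ab(2) M.compose_in[OF m aM]])
    finally show "E ((a o\<^sub>L b) o\<^sub>L m) = E (m o\<^sub>L (a o\<^sub>L b))" by (simp only: compose_assoc)
  qed
next
  fix a r assume a: "a \<in> C"
  note aM = centralizerD(1)[OF a]
  show "r *\<^sub>R a \<in> C"
  proof (rule centralizerI'[OF M.scaleR_in[OF aM] commutant_N.scaleR_in[OF centralizerD(2)[OF a]]])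
    fix m assume m: "m \<in> M"
    show "E ((r *\<^sub>R a) o\<^sub>L m) = E (m o\<^sub>L (r *\<^sub>R a))"
      unfolding compose_bilinear using centralizerD(4)[OF a m] aM m by (simp add: E_scaleR M.compose_in)
  qed
next
  fix a b assume a: "a \<in> C" and ab: "a o\<^sub>L b = id_blinfun" "b o\<^sub>L a = id_blinfun"
  note aM = centralizerD(1)[OF a]
  have bM: "b \<in> M" by (rule M.inverse_in[OF aM ab])
  show "b \<in> C"
  proof (rule centralizerI'[OF bM commutant_N.inverse_in[OF centralizerD(2)[OF a] ab]])
    fix m assume m: "m \<in> M"
    \<comment> \<open>Testing the identity for \<open>a\<close> on \<open>b m b\<close> lets one
      factor \<open>b\<close> cancel on either side.\<close>
    have "E (a o\<^sub>L (b o\<^sub>L m o\<^sub>L b)) = E ((b o\<^sub>L m o\<^sub>L b) o\<^sub>L a)"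
      by (intro centralizerD(4)[OF a] M.compose_in bM m)
    moreover have "a o\<^sub>L (b o\<^sub>L m o\<^sub>L b) = m o\<^sub>L b" "(b o\<^sub>L m o\<^sub>L b) o\<^sub>L a = b o\<^sub>L m"
      using ab by (metis compose_assoc compose_id)+
    ultimately show "E (b o\<^sub>L m) = E (m o\<^sub>L b)" by simp
  qed
next
  show "closed C"
    unfolding closed_sequential_limits
  proof (intro allI impI, elim conjE)
    fix s l assume s: "\<forall>n. s n \<in> C" and l: "s \<longlonglongrightarrow> l"
    have sM: "s n \<in> M" and sN: "s n \<in> commutant N" for n using s centralizerD(1,2) by blast+
    have lM: "l \<in> M" by (rule closed_sequentially[OF M.closed sM l])
    show "l \<in> C"
    proof (rule centralizerI'[OF lM closed_sequentially[OF commutant_N.closed sN l]])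
      fix m assume m: "m \<in> M"
      have "(\<lambda>n. E (s n o\<^sub>L m)) \<longlonglongrightarrow> E (l o\<^sub>L m)"
        by (intro E_tendsto M.compose_in sM lM m
            bounded_bilinear.tendsto[OF bounded_bilinear_blinfun_compose] l tendsto_const)
      moreover have "(\<lambda>n. E (m o\<^sub>L s n)) \<longlonglongrightarrow> E (m o\<^sub>L l)"
        by (intro E_tendsto M.compose_in sM lM m
            bounded_bilinear.tendsto[OF bounded_bilinear_blinfun_compose] l tendsto_const)
      moreover have "E (s n o\<^sub>L m) = E (m o\<^sub>L s n)" for n
        using s centralizerD(4)[OF _ m] by blast
      ultimately show "E (l o\<^sub>L m) = E (m o\<^sub>L l)" using LIMSEQ_unique by simp
    qed
  qed
next
  fix s :: "nat \<Rightarrow> _" and p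
  assume "\<And>n. s n \<in> C" "\<And>n. psd (s n)" "\<And>n. psd (id_blinfun - s n)" "\<And>n. psd (s (Suc n) - s n)"
    "\<And>x. (\<lambda>n. blinfun_apply (s n) x) \<longlonglongrightarrow> blinfun_apply p x"
  then show "p \<in> C" by (rule centralizer_monotone_limit)
next
  show "C \<subseteq> bounded_ops" using centralizerD(1) M_bounded_ops by blast
next
  fix a c assume a: "a \<in> C"
  note aM = centralizerD(1)[OF a]
  show "cscale_op c a \<in> C"
  proof (rule centralizerI'[OF M.cscale_in[OF aM]
        cscale_op_commutant[OF centralizerD(2)[OF a] N.complex_linear]])
    fix m assume m: "m \<in> M"
    show "E (cscale_op c a o\<^sub>L m) = E (m o\<^sub>L cscale_op c a)"
      using centralizerD(4)[OF a m] aM m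
      by (simp add: cscale_op_compose_left cscale_op_compose_right[OF M_bounded_ops[OF m]]
          E_cscale M.compose_in)
  qed
next
  fix a assume a: "a \<in> C"
  note aM = centralizerD(1)[OF a]
  obtain b where b: "b \<in> M" "\<And>x y. inner (blinfun_apply a x) y = inner x (blinfun_apply b y)"
    using M.inner_adjoint[OF aM] by metis
  have b': "inner (blinfun_apply b x) y = inner x (blinfun_apply a y)" for x y
    using b(2)[of y x] by (simp add: inner_commute)
  have "b \<in> C"
  proof (rule centralizerI[OF b(1)])
    fix n assume n: "n \<in> N"
    obtain n' where n': "n' \<in> N" "\<And>x y. inner (blinfun_apply n x) y = inner x (blinfun_apply n' y)"
      using N.inner_adjoint[OF n] by metis
    have n'': "inner (blinfun_apply n' x) y = inner x (blinfun_apply n y)" for x y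
      using n'(2)[of y x] by (simp add: inner_commute)
    have comm: "blinfun_apply a (blinfun_apply n' x) = blinfun_apply n' (blinfun_apply a x)" for x
      using centralizerD(3)[OF a n'(1)] by (metis blinfun_apply_blinfun_compose)
    \<comment> \<open>Both sides are adjoints of the same operator \<open>n' a\<close>, because
      \<open>a\<close> commutes with \<open>n'\<close>; the expectation identity below is
      transferred from \<open>a\<close> to its adjoint in the same manner.\<close>
    show "b o\<^sub>L n = n o\<^sub>L b"
    proof (rule adjoint_unique)
      show "inner (blinfun_apply (n' o\<^sub>L a) x) y = inner x (blinfun_apply (b o\<^sub>L n) y)" for x y
        by (simp add: n'' b(2))
      show "inner (blinfun_apply (n' o\<^sub>L a) x) y = inner x (blinfun_apply (n o\<^sub>L b) y)" for x y
        by (simp add: b(2) n'' flip: comm)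
    qed
  next
    fix m assume m: "m \<in> M"
    obtain m' where m': "m' \<in> M" "\<And>x y. inner (blinfun_apply m x) y = inner x (blinfun_apply m' y)"
      using M.inner_adjoint[OF m] by metis
    have m'': "inner (blinfun_apply m' x) y = inner x (blinfun_apply m y)" for x y
      using m'(2)[of y x] by (simp add: inner_commute)
    show "E (b o\<^sub>L m) = E (m o\<^sub>L b)"
    proof (rule adjoint_unique)
      show "inner (blinfun_apply (E (m' o\<^sub>L a)) x) y = inner x (blinfun_apply (E (b o\<^sub>L m)) y)" for x y
        using m m' aM b by (intro E_adjoint M.compose_in) (simp_all add: m'')
      have "inner (blinfun_apply (E (a o\<^sub>L m')) x) y = inner x (blinfun_apply (E (m o\<^sub>L b)) y)" for x y
        using m m' aM b by (intro E_adjoint M.compose_in) (simp_all add: m'')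
      then show "inner (blinfun_apply (E (m' o\<^sub>L a)) x) y = inner x (blinfun_apply (E (m o\<^sub>L b)) y)" for x y
        using centralizerD(4)[OF a m'(1)] by simp
    qed
  qed
  moreover have "is_adjoint a b"
    using is_adjoint_iff_inner[OF M_bounded_ops[OF b(1)]] b(2) by blast
  ultimately show "\<exists>b\<in>C. is_adjoint a b" by blast
qed

subsection \<open>The isotropy group\<close>

text \<open>The invariance of \<open>E\<close> under \<open>g\<close>, with the inverse as an
  explicit argument and \<open>x\<close> replaced by its conjugate: \<open>E\<close> commutes with
  conjugation by \<open>g\<close>. Membership in the isotropy group becomes the existence of
  \<open>h\<close>.\<close>

definition fixes_E where
  "fixes_E g h \<longleftrightarrow> g \<in> M \<and> h \<in> M \<and> g o\<^sub>L h = id_blinfun \<and> h o\<^sub>L g = id_blinfun \<and>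
    (\<forall>x\<in>M. E (g o\<^sub>L (x o\<^sub>L h)) = g o\<^sub>L (E x o\<^sub>L h))"

lemma fixes_ED:
  assumes "fixes_E g h"
  shows "g \<in> M" "h \<in> M" "g o\<^sub>L h = id_blinfun" "h o\<^sub>L g = id_blinfun"
    "x \<in> M \<Longrightarrow> E (g o\<^sub>L (x o\<^sub>L h)) = g o\<^sub>L (E x o\<^sub>L h)"
  using assms by (auto simp: fixes_E_def)

lemma isotropy_group_iff: "g \<in> isotropy_group M E \<longleftrightarrow> (\<exists>h. fixes_E g h)"
proof
  assume "g \<in> isotropy_group M E"
  then obtain h where gh: "g \<in> M" "h \<in> M" "g o\<^sub>L h = id_blinfun" "h o\<^sub>L g = id_blinfun"
    and conj: "\<And>x. x \<in> M \<Longrightarrow> conj_exp M g E x = E x"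
    by (auto simp: isotropy_group_def units_of_carrier Units_op_monoid)
  have "E (g o\<^sub>L (x o\<^sub>L h)) = g o\<^sub>L (E x o\<^sub>L h)" if x: "x \<in> M" for x
  proof -
    have "h o\<^sub>L (g o\<^sub>L (x o\<^sub>L h)) o\<^sub>L g = x"
      using gh(4) by (simp add: compose_assoc cancel_inverse)
    then show ?thesis
      using conj[of "g o\<^sub>L (x o\<^sub>L h)"] gh x
      by (simp add: conj_exp_def inv_inv_group[OF gh] Let_def M.compose_in compose_assoc)
  qed
  then show "\<exists>h. fixes_E g h" using gh by (auto simp: fixes_E_def)
next
  assume "\<exists>h. fixes_E g h"
  then obtain h where fix_gh: "fixes_E g h" by blast
  note gh = fixes_ED[OF fix_gh]
  have "conj_exp M g E x = E x" if x: "x \<in> M" for x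
  proof -
    have "h o\<^sub>L x o\<^sub>L g \<in> M" by (intro M.compose_in gh x)
    from gh(5)[OF this] show ?thesis
      using gh(3)
      by (simp add: conj_exp_def inv_inv_group[OF gh(1-4)] Let_def compose_assoc cancel_inverse)
  qed
  then show "g \<in> isotropy_group M E"
    using gh by (auto simp: isotropy_group_def units_of_carrier Units_op_monoid)
qed

lemma fixes_E_compose:
  assumes "fixes_E g h" "fixes_E g' h'"
  shows "fixes_E (g o\<^sub>L g') (h' o\<^sub>L h)"
proof -
  note gh = fixes_ED[OF assms(1)] and gh' = fixes_ED[OF assms(2)]
  have "E ((g o\<^sub>L g') o\<^sub>L (x o\<^sub>L (h' o\<^sub>L h))) = (g o\<^sub>L g') o\<^sub>L (E x o\<^sub>L (h' o\<^sub>L h))" if x: "x \<in> M" for x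
  proof -
    have "E (g o\<^sub>L ((g' o\<^sub>L (x o\<^sub>L h')) o\<^sub>L h)) = g o\<^sub>L (E (g' o\<^sub>L (x o\<^sub>L h')) o\<^sub>L h)"
      by (intro gh(5) M.compose_in gh' x)
    then show ?thesis by (simp add: gh'(5)[OF x] compose_assoc)
  qed
  moreover have "(g o\<^sub>L g') o\<^sub>L (h' o\<^sub>L h) = id_blinfun" "(h' o\<^sub>L h) o\<^sub>L (g o\<^sub>L g') = id_blinfun"
    using gh gh' by (simp_all add: compose_assoc cancel_inverse)
  ultimately show ?thesis using gh gh' by (simp add: fixes_E_def M.compose_in)
qed

lemma fixes_E_inverse:
  assumes "fixes_E g h"
  shows "fixes_E h g"
proof -
  note gh = fixes_ED[OF assms]
  have "E (h o\<^sub>L (x o\<^sub>L g)) = h o\<^sub>L (E x o\<^sub>L g)" if x: "x \<in> M" for x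
  proof -
    have "E (g o\<^sub>L ((h o\<^sub>L (x o\<^sub>L g)) o\<^sub>L h)) = g o\<^sub>L (E (h o\<^sub>L (x o\<^sub>L g)) o\<^sub>L h)"
      by (intro gh(5) M.compose_in gh x)
    then have "E x = g o\<^sub>L (E (h o\<^sub>L (x o\<^sub>L g)) o\<^sub>L h)"
      using gh(3) by (simp add: compose_assoc cancel_inverse)
    then show ?thesis using gh(4) by (simp add: compose_assoc cancel_inverse)
  qed
  then show ?thesis using gh by (simp add: fixes_E_def)
qed

lemma fixes_E_N:
  assumes "n \<in> N" "k \<in> N" "n o\<^sub>L k = id_blinfun" "k o\<^sub>L n = id_blinfun"
  shows "fixes_E n k"
  using assms by (simp add: fixes_E_def N_sub E_left E_right M.compose_in)

text \<open>The centralizer identity moves \<open>m\<close> past \<open>x k\<close>, giving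
  \<open>E x\<close>; this lies in \<open>N\<close>, so conjugation by \<open>m\<close> leaves it
  unchanged.\<close>

lemma fixes_E_centralizer:
  assumes m: "m \<in> C" and k: "k \<in> C" and mk: "m o\<^sub>L k = id_blinfun" "k o\<^sub>L m = id_blinfun"
  shows "fixes_E m k"
proof -
  have "E (m o\<^sub>L (x o\<^sub>L k)) = m o\<^sub>L (E x o\<^sub>L k)" if x: "x \<in> M" for x
  proof -
    have "E (m o\<^sub>L (x o\<^sub>L k)) = E ((x o\<^sub>L k) o\<^sub>L m)"
      by (intro centralizerD(4)[OF m] M.compose_in x centralizerD(1)[OF k])
    also have "\<dots> = E x" using mk(2) by (simp add: compose_assoc)
    also have "\<dots> = m o\<^sub>L (k o\<^sub>L E x)" using mk by (simp add: cancel_inverse)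
    finally show ?thesis using centralizerD(3)[OF k E_in[OF x]] by simp
  qed
  then show ?thesis using mk centralizerD(1)[OF m] centralizerD(1)[OF k] by (simp add: fixes_E_def)
qed

lemma mem_Z_group_if_E_invertible:
  assumes "fixes_E g h" and w: "w \<in> N" "E g o\<^sub>L w = id_blinfun" "w o\<^sub>L E g = id_blinfun"
  shows "g \<in> Z_group M N E"
proof -
  note gh = fixes_ED[OF assms(1)]
  define v where "v = E g"
  have v: "v \<in> N" "v o\<^sub>L w = id_blinfun" "w o\<^sub>L v = id_blinfun"
    using E_in[OF gh(1)] w by (simp_all add: v_def)
  define m where "m = w o\<^sub>L g"
  define k where "k = h o\<^sub>L v"
  have mk: "fixes_E m k"
    unfolding m_def k_def by (rule fixes_E_compose[OF fixes_E_N[OF w(1) v(1,3,2)] assms(1)])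
  note mk' = fixes_ED[OF mk]
  have comm: "m o\<^sub>L n = n o\<^sub>L m" if n: "n \<in> N" for n
  proof -
    define \<theta> where "\<theta> = g o\<^sub>L (n o\<^sub>L h)"
    \<comment> \<open>Invariance under conjugation and \<open>E n = n\<close> make
      \<open>\<theta>\<close> a fixed point of \<open>E\<close>, which places it in
      \<open>N\<close>.\<close>
    have "E \<theta> = \<theta>" unfolding \<theta>_def using gh(5)[OF N_sub[OF n]] by (simp add: E_fix n)
    moreover have "\<theta> \<in> M" unfolding \<theta>_def by (intro M.compose_in gh N_sub n)
    ultimately have \<theta>: "\<theta> \<in> N" using E_in by metis
    have gn: "g o\<^sub>L n = \<theta> o\<^sub>L g" unfolding \<theta>_def using gh(4) by (simp add: compose_assoc)
    have "v o\<^sub>L n = E (g o\<^sub>L n)" by (simp add: v_def E_right n gh)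
    also have "\<dots> = \<theta> o\<^sub>L v" by (simp add: gn v_def E_left \<theta> gh)
    finally have "w o\<^sub>L (v o\<^sub>L n) o\<^sub>L w = w o\<^sub>L (\<theta> o\<^sub>L v) o\<^sub>L w" by simp
    then have "n o\<^sub>L w = w o\<^sub>L \<theta>" using v by (simp add: compose_assoc cancel_inverse)
    then have "n o\<^sub>L m = w o\<^sub>L (\<theta> o\<^sub>L g)" unfolding m_def by (metis compose_assoc)
    then show ?thesis by (simp add: m_def compose_assoc flip: gn)
  qed
  have "m \<in> C"
  proof (rule centralizerI[OF mk'(1) comm])
    fix x assume x: "x \<in> M"
    \<comment> \<open>Inserting \<open>m k\<close> exhibits \<open>m x\<close> as the conjugate of
      \<open>x m\<close> by \<open>m\<close>. \<open>E\<close> commutes with this conjugation, which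
      acts trivially on \<open>N\<close>.\<close>
    have "E (m o\<^sub>L x) = E (m o\<^sub>L ((x o\<^sub>L m) o\<^sub>L k))"
      using mk'(3) by (simp add: compose_assoc)
    also have "\<dots> = m o\<^sub>L (E (x o\<^sub>L m) o\<^sub>L k)"
      by (intro mk'(5) M.compose_in x mk')
    also have "\<dots> = E (x o\<^sub>L m)"
    proof -
      have "m o\<^sub>L E (x o\<^sub>L m) = E (x o\<^sub>L m) o\<^sub>L m" by (intro comm E_in M.compose_in x mk')
      then show ?thesis using cancel_inverse(2)[OF mk'(3)] by (metis compose_assoc)
    qed
    finally show "E (m o\<^sub>L x) = E (x o\<^sub>L m)" .
  qed
  then have "m \<in> Units (op_monoid C)" by (rule C.Units_op_monoidI) (rule mk')+
  moreover have "v \<in> Units (op_monoid N)" by (rule N.Units_op_monoidI) (rule v)+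
  \<comment> \<open>Since \<open>m\<close> commutes with \<open>v\<close>, the product is also
    \<open>v w g\<close>.\<close>
  moreover have "g = m o\<^sub>L v"
    unfolding comm[OF v(1)] using v(2) by (simp add: m_def cancel_inverse)
  ultimately show ?thesis by (auto simp: Z_group_def units_of_carrier)
qed

lemma Z_groupE:
  assumes "z \<in> Z_group M N E"
  obtains m k n l where "z = m o\<^sub>L n" "m \<in> C" "k \<in> C" "m o\<^sub>L k = id_blinfun" "k o\<^sub>L m = id_blinfun"
    "n \<in> N" "l \<in> N" "n o\<^sub>L l = id_blinfun" "l o\<^sub>L n = id_blinfun"
  using assms by (auto simp: Z_group_def units_of_carrier Units_op_monoid)

lemma Z_groupI: "m \<in> Units (op_monoid C) \<Longrightarrow> n \<in> Units (op_monoid N) \<Longrightarrow> m o\<^sub>L n \<in> Z_group M N E"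
  by (auto simp: Z_group_def units_of_carrier)

section \<open>The product group and its cosets\<close>

text \<open>The centralizer commutes with \<open>N\<close>, so the factors can be regrouped.\<close>

lemma Z_group_compose:
  assumes "y \<in> Z_group M N E" "z \<in> Z_group M N E"
  shows "y o\<^sub>L z \<in> Z_group M N E"
proof -
  obtain m n m' n' where y: "y = m o\<^sub>L n" "m \<in> Units (op_monoid C)" "n \<in> Units (op_monoid N)"
    and z: "z = m' o\<^sub>L n'" "m' \<in> Units (op_monoid C)" "n' \<in> Units (op_monoid N)"
    using assms by (auto simp: Z_group_def units_of_carrier)
  have "m' o\<^sub>L n = n o\<^sub>L m'"
    using y(3) z(2) by (intro centralizerD(3)) (auto simp: Units_op_monoid)
  then have "y o\<^sub>L z = (m o\<^sub>L m') o\<^sub>L (n o\<^sub>L n')" unfolding y(1) z(1) by (metis compose_assoc)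
  then show ?thesis
    using Z_groupI[OF C.compose_Units[OF y(2) z(2)] N.compose_Units[OF y(3) z(3)]] by simp
qed

lemma Z_group_inverse:
  assumes "z \<in> Z_group M N E"
  obtains z' where "z' \<in> Z_group M N E" "z o\<^sub>L z' = id_blinfun" "z' o\<^sub>L z = id_blinfun"
    "fixes_E z z'"
proof -
  obtain m k n l where z: "z = m o\<^sub>L n" "m \<in> C" "k \<in> C" "m o\<^sub>L k = id_blinfun" "k o\<^sub>L m = id_blinfun"
    "n \<in> N" "l \<in> N" "n o\<^sub>L l = id_blinfun" "l o\<^sub>L n = id_blinfun"
    using Z_groupE[OF assms] by metis
  have fz: "fixes_E z (l o\<^sub>L k)"
    unfolding z(1) by (intro fixes_E_compose fixes_E_centralizer fixes_E_N z)
  have "k o\<^sub>L l \<in> Z_group M N E"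
    by (rule Z_groupI[OF C.Units_op_monoidI[OF z(3,5,4)] N.Units_op_monoidI[OF z(7,9,8)]])
  then have "l o\<^sub>L k \<in> Z_group M N E" using centralizerD(3)[OF z(3,7)] by simp
  then show thesis using that fz fixes_ED[OF fz] by blast
qed

lemma Z_group_subset_isotropy: "Z_group M N E \<subseteq> isotropy_group M E"
  using Z_group_inverse isotropy_group_iff by (metis subsetI)

lemma id_in_Z_group: "id_blinfun \<in> Z_group M N E"
  using Z_groupI[OF C.Units_op_monoidI[OF C.id_in] N.Units_op_monoidI[OF N.id_in], of id_blinfun id_blinfun]
  by simp

lemma subgroup_Z_group: "subgroup (Z_group M N E) (inv_group M)"
proof (rule subgroup.intro)
  show "Z_group M N E \<subseteq> carrier (inv_group M)"
    using Z_group_subset_isotropy by (auto simp: isotropy_group_def)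
  show "y \<otimes>\<^bsub>inv_group M\<^esub> z \<in> Z_group M N E" if "y \<in> Z_group M N E" "z \<in> Z_group M N E" for y z
    using Z_group_compose[OF that] by (simp add: units_of_mult op_monoid_def)
  show "\<one>\<^bsub>inv_group M\<^esub> \<in> Z_group M N E"
    using id_in_Z_group by (simp add: units_of_one op_monoid_def)
  fix z assume "z \<in> Z_group M N E"
  then obtain z' where z': "z' \<in> Z_group M N E" "fixes_E z z'"
    using Z_group_inverse by metis
  then show "inv\<^bsub>inv_group M\<^esub> z \<in> Z_group M N E"
    using inv_inv_group[OF fixes_ED(1-4)[OF z'(2)]] by simp
qed

lemma connected_Z_group: "connected (Z_group M N E)"
proof -
  have "Z_group M N E = (\<lambda>(m, n). m o\<^sub>L n) ` (Units (op_monoid C) \<times> Units (op_monoid N))"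
    by (auto simp: Z_group_def units_of_carrier)
  moreover have "connected \<dots>"
    unfolding case_prod_unfold
    by (intro connected_continuous_image connected_Times C.connected_Units N.connected_Units
        bounded_bilinear.continuous_on[OF bounded_bilinear_blinfun_compose] continuous_intros)
  ultimately show ?thesis by simp
qed

lemma coset_subset_isotropy:
  assumes "u \<in> isotropy_group M E"
  shows "(\<lambda>z. u o\<^sub>L z) ` Z_group M N E \<subseteq> isotropy_group M E"
proof
  fix w assume "w \<in> (\<lambda>z. u o\<^sub>L z) ` Z_group M N E"
  then obtain z where z: "w = u o\<^sub>L z" "z \<in> isotropy_group M E"
    using Z_group_subset_isotropy by blast
  then obtain h k where "fixes_E u h" "fixes_E z k" using assms isotropy_group_iff by metis
  then show "w \<in> isotropy_group M E"
    unfolding z(1) isotropy_group_iff using fixes_E_compose by metis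
qed

lemma openin_coset:
  assumes u: "u \<in> isotropy_group M E"
  shows "openin (top_of_set (isotropy_group M E)) ((\<lambda>z. u o\<^sub>L z) ` Z_group M N E)"
  unfolding openin_contains_ball
proof (intro conjI coset_subset_isotropy[OF u] ballI)
  fix v assume "v \<in> (\<lambda>z. u o\<^sub>L z) ` Z_group M N E"
  then obtain z where z: "v = u o\<^sub>L z" "z \<in> Z_group M N E" by blast
  have "v \<in> isotropy_group M E" using coset_subset_isotropy[OF u] z by blast
  then obtain v' where v': "fixes_E v v'" using isotropy_group_iff by blast
  note vv' = fixes_ED[OF v']
  \<comment> \<open>For \<open>w\<close> within \<open>e\<close> of \<open>v\<close>,
    \<open>1 - v' w\<close> has norm below 1/2, and the factor 2 of \<open>E_bounded\<close> leaves
    \<open>norm (1 - E g) < 1\<close>, as the Neumann argument requires. The 1 added to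
    \<open>norm v'\<close> makes the estimate strict.\<close>
  define e where "e = 1 / (2 * (norm v' + 1))"
  have e: "0 < e" by (simp add: e_def add_nonneg_pos)
  have "w \<in> (\<lambda>z. u o\<^sub>L z) ` Z_group M N E" if w: "w \<in> ball v e \<inter> isotropy_group M E" for w
  proof -
    obtain w' where w': "fixes_E w w'" using w isotropy_group_iff by blast
    define g where "g = v' o\<^sub>L w"
    have g: "fixes_E g (w' o\<^sub>L v)"
      unfolding g_def by (rule fixes_E_compose[OF fixes_E_inverse[OF v'] w'])
    have gM: "g \<in> M" using fixes_ED(1)[OF g] .
    have "id_blinfun - g = v' o\<^sub>L (v - w)" by (simp add: g_def compose_bilinear vv')
    then have "norm (id_blinfun - g) \<le> norm v' * norm (v - w)" by (simp add: norm_blinfun_compose)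
    also have "\<dots> \<le> norm v' * e" using w by (intro mult_left_mono) (auto simp: dist_norm)
    also have "\<dots> < (norm v' + 1) * e" using e by simp
    also have "\<dots> = 1 / 2"
    proof -
      have "norm v' + 1 \<noteq> 0" using norm_ge_zero[of v'] by linarith
      then show ?thesis by (simp only: e_def divide_simps) simp
    qed
    finally have "norm (id_blinfun - g) < 1 / 2" .
    moreover have "E (id_blinfun - g) = id_blinfun - E g" by (simp add: E_diff M.id_in gM E_id)
    ultimately have "norm (id_blinfun - E g) < 1"
      using E_bounded[OF M.diff_in[OF M.id_in gM]] by simp
    then obtain k where k: "E g o\<^sub>L k = id_blinfun" "k o\<^sub>L E g = id_blinfun"
      using Neumann_invertible by blast
    then have "k \<in> N" using N.inverse_in[OF E_in[OF gM]] by blast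
    then have "g \<in> Z_group M N E" using mem_Z_group_if_E_invertible[OF g _ k] by blast
    moreover have "w = u o\<^sub>L (z o\<^sub>L g)"
      using vv'(3) by (simp add: g_def z(1)[symmetric] cancel_inverse flip: compose_assoc)
    ultimately show ?thesis using Z_group_compose[OF z(2)] by blast
  qed
  then show "\<exists>e>0. ball v e \<inter> isotropy_group M E \<subseteq> (\<lambda>z. u o\<^sub>L z) ` Z_group M N E"
    using e by blast
qed

text \<open>The complement is the union of the remaining cosets, all of them open.\<close>

lemma closedin_coset:
  assumes u: "u \<in> isotropy_group M E"
  shows "closedin (top_of_set (isotropy_group M E)) ((\<lambda>z. u o\<^sub>L z) ` Z_group M N E)"
proof -
  let ?I = "isotropy_group M E" and ?Z = "Z_group M N E"
  have "?I - (\<lambda>z. u o\<^sub>L z) ` ?Z = (\<Union>v\<in>?I - (\<lambda>z. u o\<^sub>L z) ` ?Z. (\<lambda>z. v o\<^sub>L z) ` ?Z)"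
  proof (intro equalityI subsetI)
    fix v assume "v \<in> ?I - (\<lambda>z. u o\<^sub>L z) ` ?Z"
    moreover have "v \<in> (\<lambda>z. v o\<^sub>L z) ` ?Z" using id_in_Z_group by (force intro: image_eqI)
    ultimately show "v \<in> (\<Union>v\<in>?I - (\<lambda>z. u o\<^sub>L z) ` ?Z. (\<lambda>z. v o\<^sub>L z) ` ?Z)" by blast
  next
    fix w assume "w \<in> (\<Union>v\<in>?I - (\<lambda>z. u o\<^sub>L z) ` ?Z. (\<lambda>z. v o\<^sub>L z) ` ?Z)"
    then obtain v z where v: "v \<in> ?I" "v \<notin> (\<lambda>z. u o\<^sub>L z) ` ?Z" and z: "z \<in> ?Z" "w = v o\<^sub>L z"
      by blast
    obtain z' where z': "z' \<in> ?Z" "z o\<^sub>L z' = id_blinfun" using Z_group_inverse[OF z(1)] by metis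
    have "w \<notin> (\<lambda>z. u o\<^sub>L z) ` ?Z"
    proof
      assume "w \<in> (\<lambda>z. u o\<^sub>L z) ` ?Z"
      then obtain y where y: "y \<in> ?Z" "v o\<^sub>L z = u o\<^sub>L y" unfolding z(2) image_iff by auto
      have "v = u o\<^sub>L (y o\<^sub>L z')"
        using cancel_inverse(2)[OF z'(2), of v] unfolding y(2) by (simp add: compose_assoc)
      then show False using v(2) imageI[OF Z_group_compose[OF y(1) z'(1)]] by metis
    qed
    moreover have "w \<in> ?I" using subsetD[OF coset_subset_isotropy[OF v(1)]] z by simp
    ultimately show "w \<in> ?I - (\<lambda>z. u o\<^sub>L z) ` ?Z" by simp
  qed
  moreover have "openin (top_of_set ?I) \<dots>"
    by (intro openin_Union) (auto intro: openin_coset)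
  ultimately show ?thesis
    using coset_subset_isotropy[OF u] by (simp add: closedin_def)
qed

text \<open>The coset is a connected set containing \<open>u\<close>, hence lies in the component;
  being clopen there and nonempty, it is the whole component.\<close>

lemma connected_component_isotropy:
  assumes u: "u \<in> isotropy_group M E"
  shows "connected_component_set (isotropy_group M E) u = (\<lambda>z. u o\<^sub>L z) ` Z_group M N E"
proof -
  let ?I = "isotropy_group M E" and ?uZ = "(\<lambda>z. u o\<^sub>L z) ` Z_group M N E"
  let ?K = "connected_component_set ?I u"
  have uZ: "u \<in> ?uZ" using id_in_Z_group by (force intro: image_eqI)
  have "connected ?uZ"
    by (intro connected_continuous_image connected_Z_group
        bounded_bilinear.continuous_on[OF bounded_bilinear_blinfun_compose] continuous_intros)
  then have sub: "?uZ \<subseteq> ?K"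
    using connected_component_maximal[OF uZ] coset_subset_isotropy[OF u] by blast
  have K: "?K \<subseteq> ?I" by (rule connected_component_subset)
  have "openin (top_of_set ?K) ?uZ" "closedin (top_of_set ?K) ?uZ"
    by (rule openin_subset_trans[OF openin_coset[OF u] sub K],
        rule closedin_subset_trans[OF closedin_coset[OF u] sub K])
  moreover have "connected ?K" by simp
  ultimately show ?thesis using uZ unfolding connected_clopen by blast
qed

end

theorem proposition3p3:
  fixes M N :: "('h::chilbert_space \<Rightarrow>\<^sub>L 'h) set"
    and E :: "('h \<Rightarrow>\<^sub>L 'h) \<Rightarrow> ('h \<Rightarrow>\<^sub>L 'h)"
  assumes "von_neumann_algebra M"
    and "conditional_expectation M N E"
    and "normal_map M N E"
    and "faithful_map M E"
  shows "subgroup (Z_group M N E) (inv_group M) \<and>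
    Z_group M N E \<subseteq> isotropy_group M E \<and>
    openin (top_of_set (isotropy_group M E)) (Z_group M N E) \<and>
    closedin (top_of_set (isotropy_group M E)) (Z_group M N E) \<and>
    connected (Z_group M N E) \<and>
    (\<forall>u \<in> isotropy_group M E.
       connected_component_set (isotropy_group M E) u = (\<lambda>z. u o\<^sub>L z) ` Z_group M N E)"
proof -
  interpret normal_expectation M N E
    by unfold_locales (use assms in auto)
  have id: "id_blinfun \<in> isotropy_group M E"
    using id_in_Z_group Z_group_subset_isotropy by blast
  have "(\<lambda>z. id_blinfun o\<^sub>L z) ` Z_group M N E = Z_group M N E" by simp
  then show ?thesis
    using subgroup_Z_group Z_group_subset_isotropy openin_coset[OF id] closedin_coset[OF id]
      connected_Z_group connected_component_isotropy
    by auto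
qed

end
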